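(* Assume: (i) for every $k\in\{1,\dots,K\}$, $\sum_{i=1}^N d^k_{ij}=0$ for all $j$ and $\sum_{j=1}^N d^k_{ij}=0$ for all $i$; (ii) the matrices $d^1,\dots,d^K$ are linearly independent; (iii) $\hat\pi_{ij}>0$ for all $(i,j)\in\{1,\dots,N\}^2$. Then the sequence $x^t:=(u^t,v^t,\beta^t)$ generated by the SISTA algorithm with step $\rho$ converges, as $t\to+\infty$, to the solution $x^*=(u^*,v^*,\beta^* )$ of $$\min_{u,v,\beta}\Phi(u,v,\beta),$$ provided the step $\rho>0$ is chosen small enough. Moreover, in this case, there exists $\delta>0$ such that $$\Phi(x^t)-\Phi(x^* )\le \frac{\Phi(x^0)-\Phi(x^* )}{(1+\delta)^t}\qquad\text{for all } t\in\mathbb{N}.$$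
   Context: Let $\hat\pi=(\hat\pi_{ij})$ be a probability on $\{1,\dots,N\}^2$ with margins $p_i=\sum_j\hat\pi_{ij}$ and $q_j=\sum_i\hat\pi_{ij}$, let $d^1,\dots,d^K$ be real $N\times N$ matrices (dissimilarity measures), and let $\gamma>0$ be a regularization parameter. For $\beta\in\mathbb{R}^K$ set $c^\beta_{ij}=\sum_{k=1}^K\beta_k d^k_{ij}$. For $(u,v,\beta)\in\mathbb{R}^N\times\mathbb{R}^N\times\mathbb{R}^K$ define $$F(u,v,\beta)=\sum_{1\le i,j\le N}\exp(u_i+v_j-c^\beta_{ij})+\sum_{1\le i,j\le N}\hat\pi_{ij}\,(c^\beta_{ij}-u_i-v_j),$$ $$\Phi(u,v,\beta)=F(u,v,\beta)+\gamma|\beta|_1,\qquad |\beta|_1=\sum_{k=1}^K|\beta_k|.$$ Normalization: $\Phi(u+m,v-m,\beta)=\Phi(u,v,\beta)$ for every constant vector $m$. This invariance is removed by imposing the normalization $u_1=0$, that is, by working in $E=\{(u,v,\beta)\in\mathbb{R}^N\times\mathbb{R}^N\times\mathbb{R}^K: u_1=0\}\simeq\mathbb{R}^{2N-1+K}$. With this normalization, and under (i)-(iii), the minimization problem has a unique solution; this is "the solution" $x^*$. The soft-thresholding operator is, for $z\in\mathbb{R}$: $\mathrm{prox}_{\rho\gamma|\cdot|}(z)=z-\rho\gamma$ if $z>\rho\gamma$, $=0$ if $|z|\le\rho\gamma$, and $=z+\rho\gamma$ if $z<-\rho\gamma$. SISTA algorithm with step $\rho>0$: start from an initial guess $x^0=(u^0,v^0,\beta^0)$;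 given $(u^t,v^t,\beta^t)$, define $(u^{t+1},v^{t+1},\beta^{t+1})$ as follows. (Sinkhorn step) For all $i$, and then for all $j$, $$\exp(u_i^{t+1})=\frac{p_i}{\sum_{j=1}^N\exp(v_j^t-c_{ij}^{\beta^t})},\qquad \exp(v_j^{t+1})=\frac{q_j}{\sum_{i=1}^N\exp(u_i^{t+1}-c_{ij}^{\beta^t})}.$$ (ISTA step) Set $\pi^{\beta^t}_{ij}=\exp(u_i^{t+1}+v_j^{t+1}-c_{ij}^{\beta^t})$ and, for $k=1,\dots,K$, $$\beta_k^{t+1}=\mathrm{prox}_{\rho\gamma|\cdot|}\Big(\beta_k^t-\rho\sum_{1\le i,j\le N}(\hat\pi_{ij}-\pi^{\beta^t}_{ij})\,d^k_{ij}\Big).$$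
   Formalization: The iterates as displayed need not keep u_1=0 and so need not converge to the normalized solution; convergence is stated for the normalized iterates (u^t-u^t_1, v^t+u^t_1, β^t), which leave Φ unchanged. *)

theory Defs
  imports "HOL-Analysis.Analysis"
begin

text \<open>
  The index sets \<open>{1,...,N}\<close> and \<open>{1,...,K}\<close> are finite types \<open>'n\<close> and \<open>'k\<close>.
  A point \<open>(u, v, \<beta>)\<close> is a triple in the product space below.
\<close>

type_synonym ('n, 'k) point = "(real ^ 'n) \<times> (real ^ 'n) \<times> (real ^ 'k)"

definition probability_matrix :: "real ^ 'n ^ 'n \<Rightarrow> bool" where
  "probability_matrix P \<longleftrightarrow>
     (\<forall>i j. 0 \<le> P $ i $ j) \<and> (\<Sum>i\<in>UNIV. \<Sum>j\<in>UNIV. P $ i $ j) = 1"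

definition row_margin :: "real ^ 'n ^ 'n \<Rightarrow> 'n \<Rightarrow> real" where
  "row_margin P i = (\<Sum>j\<in>UNIV. P $ i $ j)"

definition col_margin :: "real ^ 'n ^ 'n \<Rightarrow> 'n \<Rightarrow> real" where
  "col_margin P j = (\<Sum>i\<in>UNIV. P $ i $ j)"

definition cost :: "('k::finite \<Rightarrow> real ^ 'n ^ 'n) \<Rightarrow> real ^ 'k \<Rightarrow> real ^ 'n ^ 'n" where
  "cost d \<beta> = (\<Sum>k\<in>UNIV. \<beta> $ k *\<^sub>R d k)"

fun F :: "real ^ 'n ^ 'n \<Rightarrow> ('k::finite \<Rightarrow> real ^ 'n ^ 'n) \<Rightarrow> ('n, 'k) point \<Rightarrow> real" where
  "F P d (u, v, \<beta>) =
     (\<Sum>i\<in>UNIV. \<Sum>j\<in>UNIV. exp (u $ i + v $ j - cost d \<beta> $ i $ j)) +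
     (\<Sum>i\<in>UNIV. \<Sum>j\<in>UNIV. P $ i $ j * (cost d \<beta> $ i $ j - u $ i - v $ j))"

fun \<Phi> :: "real ^ 'n ^ 'n \<Rightarrow> ('k::finite \<Rightarrow> real ^ 'n ^ 'n) \<Rightarrow> real \<Rightarrow> ('n, 'k) point \<Rightarrow> real" where
  "\<Phi> P d \<gamma> (u, v, \<beta>) = F P d (u, v, \<beta>) + \<gamma> * (\<Sum>k\<in>UNIV. \<bar>\<beta> $ k\<bar>)"

text \<open>
  A finite type has no canonical first element, so the index called 1 in the
  normalization \<open>u\<^sub>1 = 0\<close> is a parameter \<open>i0\<close>.
\<close>

definition normalized_points :: "'n::finite \<Rightarrow> ('n, 'k::finite) point set" where
  "normalized_points i0 = {(u, v, \<beta>). u $ i0 = 0}"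

definition is_solution ::
  "real ^ 'n ^ 'n \<Rightarrow> ('k::finite \<Rightarrow> real ^ 'n ^ 'n) \<Rightarrow> real \<Rightarrow> 'n \<Rightarrow> ('n, 'k) point \<Rightarrow> bool" where
  "is_solution P d \<gamma> i0 x \<longleftrightarrow> is_arg_min (\<Phi> P d \<gamma>) (\<lambda>y. y \<in> normalized_points i0) x"

text \<open>
  The Sinkhorn step does not preserve \<open>u\<^sub>1 = 0\<close>. The iterates are viewed in the
  normalized space by the representative of their class under
  \<open>(u, v, \<beta>) \<mapsto> (u + m, v - m, \<beta>)\<close>, which leaves \<open>\<Phi>\<close> unchanged and commutes
  with the algorithm.
\<close>

fun normalize_point :: "'n::finite \<Rightarrow> ('n, 'k::finite) point \<Rightarrow> ('n, 'k) point" where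
  "normalize_point i0 (u, v, \<beta>) = ((\<chi> i. u $ i - u $ i0), (\<chi> j. v $ j + u $ i0), \<beta>)"

definition soft_threshold :: "real \<Rightarrow> real \<Rightarrow> real" where
  "soft_threshold \<tau> z = (if z > \<tau> then z - \<tau> else if \<bar>z\<bar> \<le> \<tau> then 0 else z + \<tau>)"

text \<open>
  The Sinkhorn equations are stated as in the algorithm, for \<open>exp u'\<close> and \<open>exp v'\<close>.
  When the margins are positive they determine \<open>u'\<close> and \<open>v'\<close> uniquely.
\<close>

fun sista_step ::
  "real ^ 'n ^ 'n \<Rightarrow> ('k::finite \<Rightarrow> real ^ 'n ^ 'n) \<Rightarrow> real \<Rightarrow> real \<Rightarrow>
   ('n, 'k) point \<Rightarrow> ('n, 'k) point \<Rightarrow> bool" where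
  "sista_step P d \<gamma> \<rho> (u, v, \<beta>) (u', v', \<beta>') \<longleftrightarrow>
     (\<forall>i. exp (u' $ i) = row_margin P i / (\<Sum>j\<in>UNIV. exp (v $ j - cost d \<beta> $ i $ j))) \<and>
     (\<forall>j. exp (v' $ j) = col_margin P j / (\<Sum>i\<in>UNIV. exp (u' $ i - cost d \<beta> $ i $ j))) \<and>
     (\<forall>k. \<beta>' $ k = soft_threshold (\<rho> * \<gamma>)
        (\<beta> $ k - \<rho> * (\<Sum>i\<in>UNIV. \<Sum>j\<in>UNIV.
           (P $ i $ j - exp (u' $ i + v' $ j - cost d \<beta> $ i $ j)) * d k $ i $ j)))"

definition sista_sequence ::
  "real ^ 'n ^ 'n \<Rightarrow> ('k::finite \<Rightarrow> real ^ 'n ^ 'n) \<Rightarrow> real \<Rightarrow> real \<Rightarrow>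
   (nat \<Rightarrow> ('n, 'k) point) \<Rightarrow> bool" where
  "sista_sequence P d \<gamma> \<rho> x \<longleftrightarrow> (\<forall>t. sista_step P d \<gamma> \<rho> (x t) (x (Suc t)))"

end

theory Submission
  imports Defs
begin

text \<open>
  The objective sees \<open>u\<close> and \<open>v\<close> only through the matrix
  \<open>a\<^sub>i\<^sub>j = u\<^sub>i + v\<^sub>j - c\<^sup>\<beta>\<^sub>i\<^sub>j\<close>, the logarithm of the transport plan: \<open>\<Phi>\<close> is
  \<open>\<Sum>\<^sub>i\<^sub>j (exp a\<^sub>i\<^sub>j - \<pi>\<^sub>i\<^sub>j a\<^sub>i\<^sub>j) + \<gamma>|\<beta>|\<^sub>1\<close>. The matrix \<open>a\<close> does not change under
  \<open>(u + m, v - m, \<beta>)\<close>, and on the normalized points it is a linear injective function of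
  \<open>(u, v, \<beta>)\<close> (\<open>log_plan_injective\<close>; this is where the zero margins and the
  linear independence of the \<open>d\<^sup>k\<close> enter). Hence norms of normalized points are controlled by
  norms of their log-plans, and every estimate can be made entrywise on \<open>a\<close>.

  Since all \<open>\<pi>\<^sub>i\<^sub>j\<close> are positive, \<open>s \<mapsto> exp s - \<pi>\<^sub>i\<^sub>j s\<close> is coercive, so \<open>a\<close> is
  bounded on each sublevel set of \<open>\<Phi>\<close> (\<open>log_plan_sublevel_bounded\<close>). This gives a minimizer.
  On a bounded set of log-plans the exponential is strongly convex, which gives uniqueness and the
  quadratic growth of \<open>\<Phi>\<close> around the minimizer (\<open>solution_quadratic_growth\<close>).

  For the algorithm, two estimates are compared. First, one step decreases \<open>\<Phi>\<close> by at least a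
  multiple of \<open>|v' - v|\<^sup>2 + |\<beta>' - \<beta>|\<^sup>2\<close> (\<open>sinkhorn_v_strong_decrease\<close>,
  \<open>ista_decrease\<close>). Second, \<open>\<Phi>\<close> has a subgradient at the new point of size
  \<open>O(|v' - v| + |\<beta>' - \<beta>|)\<close>: each partial optimality condition solved during the step is
  violated at the new point only by the later substeps (\<open>sista_subgradient_bound\<close>). Strong
  convexity then bounds the new error by the square of that subgradient, hence by a multiple of the
  decrease: \<open>\<Phi>(x') - \<Phi>(x\<^sup>*) \<le> \<kappa> (\<Phi>(x) - \<Phi>(x'))\<close> (\<open>sista_error_bound\<close>). This is
  linear convergence with \<open>\<delta> = 1/\<kappa>\<close>, and quadratic growth turns it into convergence of the
  iterates.

  The bound on \<open>\<rho>\<close> does not depend on the starting point. After the Sinkhorn substeps the plan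
  has total mass 1, so the gradient in \<open>\<beta>\<close> is bounded by a constant that depends only on
  \<open>d\<close>; the move \<open>\<beta>' - \<beta>\<close> is then \<open>O(\<rho>)\<close> (\<open>beta_displacement\<close>), and a
  second-order expansion of the exponential around a plan of mass 1 controls the energy along it.
  Only \<open>\<kappa>\<close>, through the bound on the sublevel set of \<open>x\<^sup>0\<close>, depends on the start.
\<close>

section \<open>Scalar inequalities for the exponential and the soft threshold\<close>

lemma exp_strongly_convex:
  fixes s t M :: real
  assumes "\<bar>s\<bar> \<le> M" "\<bar>t\<bar> \<le> M"
  shows "exp s + exp s * (t - s) + exp (- M) / 2 * (t - s)\<^sup>2 \<le> exp t"
proof (cases "t = s")
  case False
  have "\<exists>\<xi>. (if t < s then t < \<xi> \<and> \<xi> < s else s < \<xi> \<and> \<xi> < t) \<and>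
      exp t = (\<Sum>m<2. exp s / fact m * (t - s) ^ m) + exp \<xi> / fact 2 * (t - s) ^ 2"
    by (rule Taylor[of 2 "\<lambda>_. exp" exp "min s t" "max s t" s t]) (use False in auto)
  then obtain \<xi> where \<xi>: "if t < s then t < \<xi> \<and> \<xi> < s else s < \<xi> \<and> \<xi> < t"
    and eq: "exp t = (\<Sum>m<2. exp s / fact m * (t - s) ^ m) + exp \<xi> / fact 2 * (t - s) ^ 2"
    by blast
  have "- M \<le> \<xi>" using \<xi> assms by (auto split: if_splits)
  then have "exp (- M) / 2 * (t - s)\<^sup>2 \<le> exp \<xi> / 2 * (t - s)\<^sup>2"
    by (intro mult_right_mono) auto
  then show ?thesis using eq by (simp add: numeral_2_eq_2)
qed simp

lemma exp_lipschitz: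
  fixes s t M :: real
  assumes "s \<le> M" "t \<le> M"
  shows "\<bar>exp t - exp s\<bar> \<le> exp M * \<bar>t - s\<bar>"
proof -
  have *: "exp b - exp a \<le> exp M * (b - a)" if "a \<le> b" "b \<le> M" for a b :: real
  proof -
    have "exp b * (1 + (a - b)) \<le> exp b * exp (a - b)"
      using exp_ge_add_one_self by (intro mult_left_mono) auto
    then have "exp b - exp a \<le> exp b * (b - a)"
      by (simp add: exp_diff algebra_simps)
    also have "\<dots> \<le> exp M * (b - a)" using that by (intro mult_right_mono) auto
    finally show ?thesis .
  qed
  show ?thesis
  proof (cases "s \<le> t")
    case True then show ?thesis using *[of s t] assms by simp
  next
    case False then show ?thesis using *[of t s] assms by simp
  qed
qed

lemma exp_le_quadratic:
  fixes x :: real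
  assumes "\<bar>x\<bar> \<le> 1"
  shows "exp x \<le> 1 + x + 2 * x\<^sup>2"
proof -
  obtain \<xi> where \<xi>: "\<bar>\<xi>\<bar> \<le> \<bar>x\<bar>" and eq: "exp x = (\<Sum>m<2. x ^ m / fact m) + exp \<xi> / fact 2 * x ^ 2"
    using Maclaurin_exp_le[of x 2] by blast
  have "exp \<xi> \<le> exp 1" using \<xi> assms by simp
  also have "\<dots> \<le> 4" using exp_le by linarith
  finally have "exp \<xi> / 2 * x\<^sup>2 \<le> 2 * x\<^sup>2" by (intro mult_right_mono) auto
  then show ?thesis using eq by (simp add: numeral_2_eq_2)
qed

text \<open>
  Linear growth in both directions: for \<open>s < 0\<close> the linear term alone suffices, for
  \<open>s \<ge> 0\<close> it is beaten by the quadratic lower bound of the exponential.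
\<close>
lemma exp_minus_linear_coercive:
  fixes p s :: real
  assumes "0 \<le> p"
  shows "p * \<bar>s\<bar> - 2 * p\<^sup>2 \<le> exp s - p * s"
proof (cases "0 \<le> s")
  case True
  have "0 \<le> (s - 2 * p)\<^sup>2" by simp
  then have "2 * p * s - 2 * p\<^sup>2 \<le> s\<^sup>2 / 2" by (simp add: power2_eq_square algebra_simps)
  also have "\<dots> \<le> exp s" using exp_lower_Taylor_quadratic[OF True] True by linarith
  finally show ?thesis using True by simp
next
  case False
  have "0 \<le> 2 * p\<^sup>2" by simp
  moreover have "p * \<bar>s\<bar> = - (p * s)" using False by simp
  ultimately show ?thesis using exp_gt_zero[of s] by linarith
qed

text \<open>
  With \<open>b\<close> the soft threshold of \<open>z\<close>, this is the optimality condition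
  \<open>z - b \<in> \<partial>(\<tau>|\<cdot>|)(b)\<close> that characterizes the proximal point.
\<close>
lemma soft_threshold_prox:
  assumes "0 \<le> \<tau>"
  shows "\<tau> * \<bar>soft_threshold \<tau> z\<bar> + (z - soft_threshold \<tau> z) * (w - soft_threshold \<tau> z) \<le> \<tau> * \<bar>w\<bar>"
proof -
  have le: "\<tau> * w \<le> \<tau> * \<bar>w\<bar>" "- (\<tau> * w) \<le> \<tau> * \<bar>w\<bar>"
    using assms mult_left_mono[of w "\<bar>w\<bar>" \<tau>] mult_left_mono[of "- w" "\<bar>w\<bar>" \<tau>] by auto
  consider "z > \<tau>" | "\<bar>z\<bar> \<le> \<tau>" | "z < - \<tau>" by linarith
  then show ?thesis
  proof cases
    case 1
    then show ?thesis using assms le by (simp add: soft_threshold_def algebra_simps)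
  next
    case 2
    have "z * w \<le> \<bar>z\<bar> * \<bar>w\<bar>" by (metis abs_ge_self abs_mult)
    also have "\<dots> \<le> \<tau> * \<bar>w\<bar>" using 2 by (intro mult_right_mono) auto
    finally show ?thesis using 2 by (auto simp: soft_threshold_def)
  next
    case 3
    then show ?thesis using assms le by (simp add: soft_threshold_def algebra_simps)
  qed
qed

lemma soft_threshold_dist:
  assumes "0 \<le> \<tau>"
  shows "\<bar>soft_threshold \<tau> z - z\<bar> \<le> \<tau>"
  using assms by (auto simp: soft_threshold_def)

section \<open>The log-plan coordinates\<close>

fun log_plan :: "('k::finite \<Rightarrow> real ^ 'n ^ 'n) \<Rightarrow> ('n, 'k) point \<Rightarrow> real ^ 'n ^ 'n" where
  "log_plan d (u, v, \<beta>) = (\<chi> i j. u $ i + v $ j - cost d \<beta> $ i $ j)"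

definition energy :: "real ^ 'n ^ 'n \<Rightarrow> real ^ 'n ^ 'n \<Rightarrow> real" where
  "energy P a = (\<Sum>i\<in>UNIV. \<Sum>j\<in>UNIV. exp (a $ i $ j) - P $ i $ j * a $ i $ j)"

lemma \<Phi>_eq_energy:
  "\<Phi> P d \<gamma> (u, v, \<beta>) = energy P (log_plan d (u, v, \<beta>)) + \<gamma> * (\<Sum>k\<in>UNIV. \<bar>\<beta> $ k\<bar>)"
  by (simp add: energy_def sum.distrib[symmetric] algebra_simps sum_subtractf)

lemma cost_add: "cost d (b + c) = cost d b + cost d c"
  by (simp add: cost_def scaleR_add_left sum.distrib)

lemma cost_scaleR: "cost d (r *\<^sub>R b) = r *\<^sub>R cost d b"
  by (simp add: cost_def scaleR_sum_right)

lemma linear_cost: "linear (cost d)"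
  by (rule linearI) (simp_all add: cost_add cost_scaleR)

lemma cost_nth: "cost d b $ i $ j = (\<Sum>k\<in>UNIV. b $ k * d k $ i $ j)"
  by (simp add: cost_def)

lemma linear_log_plan:
  fixes d :: "'k::finite \<Rightarrow> real ^ 'n::finite ^ 'n"
  shows "linear (log_plan d)"
proof (rule linearI)
  fix x y :: "('n, 'k) point" and r :: real
  obtain u v b u' v' b' where x: "x = (u, v, b)" and y: "y = (u', v', b')" by (metis prod_cases3)
  show "log_plan d (x + y) = log_plan d x + log_plan d y"
    by (simp add: x y vec_eq_iff cost_add)
  show "log_plan d (r *\<^sub>R x) = r *\<^sub>R log_plan d x"
    by (simp add: x vec_eq_iff cost_scaleR algebra_simps)
qed

lemma log_plan_normalize: "log_plan d (normalize_point i0 x) = log_plan d x"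
  by (cases x) (simp add: vec_eq_iff)

lemma \<Phi>_normalize: "\<Phi> P d \<gamma> (normalize_point i0 x) = \<Phi> P d \<gamma> x"
  by (cases x) (simp add: algebra_simps)

lemma normalize_in_normalized_points: "normalize_point i0 x \<in> normalized_points i0"
  by (cases x) (simp add: normalized_points_def)

lemma subspace_normalized: "subspace (normalized_points i0 :: ('n::finite, 'k::finite) point set)"
  by (auto simp: subspace_def normalized_points_def zero_prod_def)

lemma closed_normalized: "closed (normalized_points i0 :: ('n::finite, 'k::finite) point set)"
  by (rule closed_subspace[OF subspace_normalized])

lemma continuous_\<Phi>: "continuous_on UNIV (\<Phi> P d \<gamma>)"
proof -
  have eq: "\<Phi> P d \<gamma> = (\<lambda>x. energy P (log_plan d x) + \<gamma> * (\<Sum>k\<in>UNIV. \<bar>snd (snd x) $ k\<bar>))"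
    by (auto simp: fun_eq_iff \<Phi>_eq_energy simp del: \<Phi>.simps log_plan.simps)
  have [continuous_intros]: "continuous_on UNIV (log_plan d)"
    using linear_log_plan linear_continuous_on linear_conv_bounded_linear by blast
  show ?thesis unfolding eq energy_def
    by (intro continuous_intros)
qed

text \<open>
  If the log-plan vanishes, its row and column sums vanish. The cost contributes nothing to these
  sums, so \<open>u\<close> and \<open>v\<close> are constant, and the normalization forces both to be 0. What
  remains is a vanishing linear combination of the matrices \<open>d\<^sup>k\<close>.
\<close>
lemma log_plan_injective:
  fixes d :: "'k::finite \<Rightarrow> real ^ 'n ^ 'n"
  assumes margins: "\<forall>k. (\<forall>j. (\<Sum>i\<in>UNIV. d k $ i $ j) = 0) \<and> (\<forall>i. (\<Sum>j\<in>UNIV. d k $ i $ j) = 0)"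
    and indep: "inj d" "independent (range d)"
    and x: "x \<in> normalized_points i0" and zero: "log_plan d x = 0"
  shows "x = 0"
proof -
  obtain u v b where xe: "x = (u, v, b)" by (metis prod_cases3)
  have u0: "u $ i0 = 0" using x by (simp add: xe normalized_points_def)
  have e: "u $ i + v $ j - cost d b $ i $ j = 0" for i j
    using zero by (simp add: xe vec_eq_iff)
  have row: "(\<Sum>j\<in>UNIV. cost d b $ i $ j) = 0" for i
  proof -
    have "(\<Sum>j\<in>UNIV. cost d b $ i $ j) = (\<Sum>k\<in>UNIV. b $ k * (\<Sum>j\<in>UNIV. d k $ i $ j))"
      unfolding cost_nth sum_distrib_left by (rule sum.swap)
    then show ?thesis using margins by simp
  qed
  have col: "(\<Sum>i\<in>UNIV. cost d b $ i $ j) = 0" for j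
  proof -
    have "(\<Sum>i\<in>UNIV. cost d b $ i $ j) = (\<Sum>k\<in>UNIV. b $ k * (\<Sum>i\<in>UNIV. d k $ i $ j))"
      unfolding cost_nth sum_distrib_left by (rule sum.swap)
    then show ?thesis using margins by simp
  qed
  have r: "CARD('n) * u $ i + (\<Sum>j\<in>UNIV. v $ j) = 0" for i
  proof -
    have "(\<Sum>j\<in>UNIV. u $ i + v $ j - cost d b $ i $ j) = 0" unfolding e by simp
    then show ?thesis using row[of i] by (simp add: sum.distrib sum_subtractf)
  qed
  have c: "(\<Sum>i\<in>UNIV. u $ i) + CARD('n) * v $ j = 0" for j
  proof -
    have "(\<Sum>i\<in>UNIV. u $ i + v $ j - cost d b $ i $ j) = 0" unfolding e by simp
    then show ?thesis using col[of j] by (simp add: sum.distrib sum_subtractf)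
  qed
  have sv: "(\<Sum>j\<in>UNIV. v $ j) = 0" using r[of i0] u0 by simp
  have u: "u $ i = 0" for i using r[of i] sv by simp
  have v: "v $ j = 0" for j using c[of j] u by simp
  have "cost d b = 0" using e u v by (simp add: vec_eq_iff)
  (* Independence is a property of the set of matrices, so the coefficients are re-indexed by
     the matrices; injectivity of d makes this possible. *)
  then have "(\<Sum>m\<in>range d. b $ (inv d m) *\<^sub>R m) = 0"
    by (simp add: cost_def sum.reindex[OF indep(1)] indep(1))
  then have "\<forall>m\<in>range d. b $ (inv d m) = 0"
    using indep(2) independentD[of "range d" "range d" "\<lambda>m. b $ (inv d m)"] by auto
  then have "b $ k = 0" for k using indep(1) by auto
  then show ?thesis using u v by (simp add: xe zero_prod_def vec_eq_iff)
qed

text \<open>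
  In finite dimension an injective linear map is bounded below.
\<close>
lemma log_plan_bounded_below:
  fixes d :: "'k::finite \<Rightarrow> real ^ 'n ^ 'n"
  assumes margins: "\<forall>k. (\<forall>j. (\<Sum>i\<in>UNIV. d k $ i $ j) = 0) \<and> (\<forall>i. (\<Sum>j\<in>UNIV. d k $ i $ j) = 0)"
    and indep: "inj d" "independent (range d)"
  obtains C where "C > 0" "\<And>x. x \<in> normalized_points i0 \<Longrightarrow> norm x \<le> C * norm (log_plan d x)"
proof -
  have "\<exists>e>0. \<forall>x\<in>normalized_points i0. norm (log_plan d x) \<ge> e * norm x"
    by (rule injective_imp_isometric[OF closed_normalized subspace_normalized])
      (use log_plan_injective[OF margins indep] linear_log_plan linear_conv_bounded_linear in blast)+
  then obtain e where e: "e > 0" "\<And>x. x \<in> normalized_points i0 \<Longrightarrow> e * norm x \<le> norm (log_plan d x)"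
    by blast
  show thesis
    by (rule that[of "1 / e"]) (use e in \<open>auto simp: field_simps\<close>)
qed

text \<open>
  The bound on the log-plan gives none on \<open>u\<close> and \<open>v\<close> themselves, so it also applies to
  the iterates of the algorithm, which need not be normalized.
\<close>
lemma log_plan_sublevel_bounded:
  fixes P :: "real ^ 'n ^ 'n"
  assumes pos: "\<forall>i j. P $ i $ j > 0" and "\<gamma> \<ge> 0"
  obtains M where "M > 0" "\<And>x i j. \<Phi> P d \<gamma> x \<le> c \<Longrightarrow> \<bar>log_plan d x $ i $ j\<bar> \<le> M"
proof -
  define B where "B = \<bar>c\<bar> + (\<Sum>i\<in>UNIV. \<Sum>j\<in>UNIV. 2 * (P $ i $ j)\<^sup>2)"
  define M where "M = (\<Sum>i\<in>UNIV. \<Sum>j\<in>UNIV. B / P $ i $ j) + 1"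
  have B0: "0 \<le> B" by (auto simp: B_def intro!: add_nonneg_nonneg sum_nonneg)
  have B0': "0 \<le> B / P $ i $ j" for i j using B0 pos by (simp add: less_imp_le)
  have "M > 0" using B0' by (auto simp: M_def intro!: add_nonneg_pos sum_nonneg)
  moreover have "\<bar>log_plan d x $ i $ j\<bar> \<le> M" if c: "\<Phi> P d \<gamma> x \<le> c" for x i j
  proof -
    obtain u v b where x: "x = (u, v, b)" by (metis prod_cases3)
    let ?a = "log_plan d x"
    have "P $ i $ j * \<bar>?a $ i $ j\<bar> \<le> (\<Sum>j\<in>UNIV. P $ i $ j * \<bar>?a $ i $ j\<bar>)"
      using pos by (intro member_le_sum) (auto simp: less_imp_le)
    also have "\<dots> \<le> (\<Sum>i\<in>UNIV. \<Sum>j\<in>UNIV. P $ i $ j * \<bar>?a $ i $ j\<bar>)"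
      using pos by (intro member_le_sum[where f = "\<lambda>i. \<Sum>j\<in>UNIV. P $ i $ j * \<bar>?a $ i $ j\<bar>"])
        (auto simp: less_imp_le intro!: sum_nonneg)
    also have "\<dots> \<le> (\<Sum>i\<in>UNIV. \<Sum>j\<in>UNIV. (exp (?a $ i $ j) - P $ i $ j * ?a $ i $ j) + 2 * (P $ i $ j)\<^sup>2)"
    proof (intro sum_mono)
      fix i j
      show "P $ i $ j * \<bar>?a $ i $ j\<bar> \<le> exp (?a $ i $ j) - P $ i $ j * ?a $ i $ j + 2 * (P $ i $ j)\<^sup>2"
        using exp_minus_linear_coercive[of "P $ i $ j" "?a $ i $ j"] pos by (simp add: less_imp_le)
    qed
    also have "\<dots> = energy P ?a + (\<Sum>i\<in>UNIV. \<Sum>j\<in>UNIV. 2 * (P $ i $ j)\<^sup>2)"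
      by (simp add: energy_def sum.distrib)
    also have "energy P ?a \<le> \<Phi> P d \<gamma> x"
      using \<open>\<gamma> \<ge> 0\<close> unfolding x \<Phi>_eq_energy by (simp add: sum_nonneg)
    finally have "P $ i $ j * \<bar>?a $ i $ j\<bar> \<le> B" using c by (simp add: B_def)
    then have "\<bar>?a $ i $ j\<bar> \<le> B / P $ i $ j" using pos by (simp add: field_simps)
    also have "\<dots> \<le> (\<Sum>j\<in>UNIV. B / P $ i $ j)"
      using B0' by (intro member_le_sum) auto
    also have "\<dots> \<le> (\<Sum>i\<in>UNIV. \<Sum>j\<in>UNIV. B / P $ i $ j)"
      using B0' by (intro member_le_sum[where f = "\<lambda>i. \<Sum>j\<in>UNIV. B / P $ i $ j"]) (auto intro!: sum_nonneg)
    finally show ?thesis by (simp add: M_def)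
  qed
  ultimately show thesis using that by blast
qed

section \<open>Convexity of the energy\<close>

lemma norm_matrix_sq: "(norm (a :: real ^ 'n ^ 'm))\<^sup>2 = (\<Sum>i\<in>UNIV. \<Sum>j\<in>UNIV. (a $ i $ j)\<^sup>2)"
  unfolding power2_norm_eq_inner inner_vec_def inner_real_def by (simp only: power2_eq_square)

lemma norm_vector_sq: "(norm (a :: real ^ 'n))\<^sup>2 = (\<Sum>i\<in>UNIV. (a $ i)\<^sup>2)"
  unfolding power2_norm_eq_inner inner_vec_def inner_real_def by (simp only: power2_eq_square)

lemma energy_convex:
  "energy P b + (\<Sum>i\<in>UNIV. \<Sum>j\<in>UNIV. (exp (b $ i $ j) - P $ i $ j) * (a $ i $ j - b $ i $ j)) \<le> energy P a"
proof -
  have "exp (b $ i $ j) - P $ i $ j * b $ i $ j + (exp (b $ i $ j) - P $ i $ j) * (a $ i $ j - b $ i $ j)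
      \<le> exp (a $ i $ j) - P $ i $ j * a $ i $ j" for i j
  proof -
    have "exp (b $ i $ j) * (1 + (a $ i $ j - b $ i $ j)) \<le> exp (b $ i $ j) * exp (a $ i $ j - b $ i $ j)"
      by (intro mult_left_mono exp_ge_add_one_self) auto
    then show ?thesis by (simp add: exp_diff algebra_simps)
  qed
  then show ?thesis unfolding energy_def sum.distrib[symmetric] by (intro sum_mono)
qed

lemma energy_strongly_convex:
  assumes "\<And>i j. \<bar>a $ i $ j\<bar> \<le> M" "\<And>i j. \<bar>b $ i $ j\<bar> \<le> M"
  shows "energy P b + (\<Sum>i\<in>UNIV. \<Sum>j\<in>UNIV. (exp (b $ i $ j) - P $ i $ j) * (a $ i $ j - b $ i $ j))
    + exp (- M) / 2 * (norm (a - b))\<^sup>2 \<le> energy P a"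
proof -
  have "exp (b $ i $ j) - P $ i $ j * b $ i $ j + (exp (b $ i $ j) - P $ i $ j) * (a $ i $ j - b $ i $ j)
      + exp (- M) / 2 * (a $ i $ j - b $ i $ j)\<^sup>2
      \<le> exp (a $ i $ j) - P $ i $ j * a $ i $ j" for i j
    using exp_strongly_convex[OF assms(2)[of i j] assms(1)[of i j]] by (simp add: algebra_simps)
  then show ?thesis
    unfolding energy_def norm_matrix_sq sum_distrib_left sum.distrib[symmetric] vector_minus_component
    by (intro sum_mono)
qed

text \<open>
  The adjoint of the log-plan map sends a matrix to its row sums, its column sums and its pairings
  with the \<open>-d\<^sup>k\<close>. With the gradient of the energy for \<open>R\<close>, these are the partial
  gradients of the objective in \<open>u\<close>, \<open>v\<close> and \<open>\<beta>\<close>.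
\<close>
lemma log_plan_adjoint:
  "(\<Sum>i\<in>UNIV. \<Sum>j\<in>UNIV. R i j * log_plan d (u, v, \<beta>) $ i $ j) =
     (\<Sum>i\<in>UNIV. (\<Sum>j\<in>UNIV. R i j) * u $ i) + (\<Sum>j\<in>UNIV. (\<Sum>i\<in>UNIV. R i j) * v $ j)
     - (\<Sum>k\<in>UNIV. (\<Sum>i\<in>UNIV. \<Sum>j\<in>UNIV. R i j * d k $ i $ j) * \<beta> $ k)"
proof -
  have v: "(\<Sum>i\<in>UNIV. \<Sum>j\<in>UNIV. R i j * v $ j) = (\<Sum>j\<in>UNIV. (\<Sum>i\<in>UNIV. R i j) * v $ j)"
    unfolding sum_distrib_right by (rule sum.swap)
  have "(\<Sum>i\<in>UNIV. \<Sum>j\<in>UNIV. R i j * cost d \<beta> $ i $ j)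
      = (\<Sum>i\<in>UNIV. \<Sum>j\<in>UNIV. \<Sum>k\<in>UNIV. R i j * d k $ i $ j * \<beta> $ k)"
    by (simp add: cost_nth sum_distrib_left mult_ac)
  also have "\<dots> = (\<Sum>i\<in>UNIV. \<Sum>k\<in>UNIV. \<Sum>j\<in>UNIV. R i j * d k $ i $ j * \<beta> $ k)"
    by (intro sum.cong refl sum.swap)
  also have "\<dots> = (\<Sum>k\<in>UNIV. \<Sum>i\<in>UNIV. \<Sum>j\<in>UNIV. R i j * d k $ i $ j * \<beta> $ k)"
    by (rule sum.swap)
  also have "\<dots> = (\<Sum>k\<in>UNIV. (\<Sum>i\<in>UNIV. \<Sum>j\<in>UNIV. R i j * d k $ i $ j) * \<beta> $ k)"
    by (simp add: sum_distrib_right)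
  finally have b: "(\<Sum>i\<in>UNIV. \<Sum>j\<in>UNIV. R i j * cost d \<beta> $ i $ j)
      = (\<Sum>k\<in>UNIV. (\<Sum>i\<in>UNIV. \<Sum>j\<in>UNIV. R i j * d k $ i $ j) * \<beta> $ k)" .
  have "(\<Sum>i\<in>UNIV. \<Sum>j\<in>UNIV. R i j * log_plan d (u, v, \<beta>) $ i $ j) =
      (\<Sum>i\<in>UNIV. \<Sum>j\<in>UNIV. R i j * u $ i) + (\<Sum>i\<in>UNIV. \<Sum>j\<in>UNIV. R i j * v $ j)
      - (\<Sum>i\<in>UNIV. \<Sum>j\<in>UNIV. R i j * cost d \<beta> $ i $ j)"
    by (simp add: sum.distrib sum_subtractf distrib_left right_diff_distrib)
  then show ?thesis unfolding b v by (simp add: sum_distrib_right)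
qed


lemma log_plan_diff: "log_plan d x $ i $ j - log_plan d y $ i $ j = log_plan d (x - y) $ i $ j"
  by (simp add: linear_diff[OF linear_log_plan])

section \<open>Decrease of the objective along one step\<close>

text \<open>
  The Sinkhorn equations in terms of plans: the first substep produces the prescribed row sums, the
  second the prescribed column sums (and destroys the row sums).
\<close>
lemma sista_step_plans:
  fixes P :: "real ^ 'n ^ 'n" and d :: "'k::finite \<Rightarrow> real ^ 'n ^ 'n"
  assumes "sista_step P d \<gamma> \<rho> (u, v, \<beta>) (u', v', \<beta>')"
  shows "(\<Sum>j\<in>UNIV. exp (log_plan d (u', v, \<beta>) $ i $ j)) = row_margin P i"
    and "(\<Sum>i\<in>UNIV. exp (log_plan d (u', v', \<beta>) $ i $ j)) = col_margin P j"
    and "\<beta>' $ k = soft_threshold (\<rho> * \<gamma>) (\<beta> $ k - \<rho> *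
      (\<Sum>i\<in>UNIV. \<Sum>j\<in>UNIV. (P $ i $ j - exp (log_plan d (u', v', \<beta>) $ i $ j)) * d k $ i $ j))"
proof -
  have "(\<Sum>j\<in>UNIV. exp (v $ j - cost d \<beta> $ i $ j)) > 0" by (intro sum_pos) auto
  then have "exp (u' $ i) * (\<Sum>j\<in>UNIV. exp (v $ j - cost d \<beta> $ i $ j)) = row_margin P i"
    using assms by simp
  then show "(\<Sum>j\<in>UNIV. exp (log_plan d (u', v, \<beta>) $ i $ j)) = row_margin P i"
    by (simp add: sum_distrib_left exp_add[symmetric] algebra_simps)
  have "(\<Sum>i\<in>UNIV. exp (u' $ i - cost d \<beta> $ i $ j)) > 0" by (intro sum_pos) auto
  then have "exp (v' $ j) * (\<Sum>i\<in>UNIV. exp (u' $ i - cost d \<beta> $ i $ j)) = col_margin P j"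
    using assms by simp
  then show "(\<Sum>i\<in>UNIV. exp (log_plan d (u', v', \<beta>) $ i $ j)) = col_margin P j"
    by (simp add: sum_distrib_left exp_add[symmetric] algebra_simps)
  show "\<beta>' $ k = soft_threshold (\<rho> * \<gamma>) (\<beta> $ k - \<rho> *
      (\<Sum>i\<in>UNIV. \<Sum>j\<in>UNIV. (P $ i $ j - exp (log_plan d (u', v', \<beta>) $ i $ j)) * d k $ i $ j))"
    using assms by simp
qed

text \<open>
  Correct row sums are the first-order condition for the minimization in \<open>u\<close> alone, and correct
  column sums are the one for \<open>v\<close>.
\<close>
lemma stationary_u:
  assumes "\<And>i. (\<Sum>j\<in>UNIV. exp (log_plan d (u', v, \<beta>) $ i $ j)) = row_margin P i"
  shows "(\<Sum>i\<in>UNIV. \<Sum>j\<in>UNIV. (exp (log_plan d (u', v, \<beta>) $ i $ j) - P $ i $ j) *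
     (log_plan d (u, v, \<beta>) $ i $ j - log_plan d (u', v, \<beta>) $ i $ j)) = 0"
  using assms unfolding log_plan_diff diff_Pair log_plan_adjoint
  by (simp add: sum_subtractf row_margin_def del: log_plan.simps)

lemma stationary_v:
  assumes "\<And>j. (\<Sum>i\<in>UNIV. exp (log_plan d (u, v', \<beta>) $ i $ j)) = col_margin P j"
  shows "(\<Sum>i\<in>UNIV. \<Sum>j\<in>UNIV. (exp (log_plan d (u, v', \<beta>) $ i $ j) - P $ i $ j) *
     (log_plan d (u, v, \<beta>) $ i $ j - log_plan d (u, v', \<beta>) $ i $ j)) = 0"
  using assms unfolding log_plan_diff diff_Pair log_plan_adjoint
  by (simp add: sum_subtractf col_margin_def del: log_plan.simps)

lemma sinkhorn_u_decrease:
  assumes "\<And>i. (\<Sum>j\<in>UNIV. exp (log_plan d (u', v, \<beta>) $ i $ j)) = row_margin P i"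
  shows "\<Phi> P d \<gamma> (u', v, \<beta>) \<le> \<Phi> P d \<gamma> (u, v, \<beta>)"
  using energy_convex[of P "log_plan d (u', v, \<beta>)" "log_plan d (u, v, \<beta>)"] stationary_u[OF assms, of u]
  unfolding \<Phi>_eq_energy by linarith

lemma sinkhorn_v_decrease:
  assumes "\<And>j. (\<Sum>i\<in>UNIV. exp (log_plan d (u, v', \<beta>) $ i $ j)) = col_margin P j"
  shows "\<Phi> P d \<gamma> (u, v', \<beta>) \<le> \<Phi> P d \<gamma> (u, v, \<beta>)"
  using energy_convex[of P "log_plan d (u, v', \<beta>)" "log_plan d (u, v, \<beta>)"] stationary_v[OF assms, of v]
  unfolding \<Phi>_eq_energy by linarith

text \<open>
  Here \<open>u\<close> stays the same, so the invariant direction is excluded and the difference of the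
  log-plans is \<open>v\<^sub>j - v'\<^sub>j\<close> in every row: it controls all of \<open>v' - v\<close>.
\<close>
lemma sinkhorn_v_strong_decrease:
  fixes u :: "real ^ 'n"
  assumes "\<And>j. (\<Sum>i\<in>UNIV. exp (log_plan d (u, v', \<beta>) $ i $ j)) = col_margin P j"
    and "\<And>i j. \<bar>log_plan d (u, v, \<beta>) $ i $ j\<bar> \<le> M" "\<And>i j. \<bar>log_plan d (u, v', \<beta>) $ i $ j\<bar> \<le> M"
  shows "\<Phi> P d \<gamma> (u, v', \<beta>) + exp (- M) / 2 * (norm (v' - v))\<^sup>2 \<le> \<Phi> P d \<gamma> (u, v, \<beta>)"
proof -
  have "(norm (v' - v))\<^sup>2 \<le> CARD('n) * (norm (v' - v))\<^sup>2"
    using mult_right_mono[of 1 "real CARD('n)" "(norm (v' - v))\<^sup>2"] by (simp add: Suc_le_eq)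
  also have "\<dots> = (norm (log_plan d (u, v, \<beta>) - log_plan d (u, v', \<beta>)))\<^sup>2"
    unfolding norm_minus_commute[of v' v] norm_matrix_sq norm_vector_sq by simp
  finally have "exp (- M) / 2 * (norm (v' - v))\<^sup>2
      \<le> exp (- M) / 2 * (norm (log_plan d (u, v, \<beta>) - log_plan d (u, v', \<beta>)))\<^sup>2"
    by (intro mult_left_mono) auto
  then show ?thesis
    using energy_strongly_convex[OF assms(2,3), of P] stationary_v[OF assms(1), of v]
    unfolding \<Phi>_eq_energy by linarith
qed

lemma abs_entry_le_norm: "\<bar>(a :: real ^ 'n ^ 'm) $ i $ j\<bar> \<le> norm a"
  using component_le_norm_cart[of "a $ i" j] Finite_Cartesian_Product.norm_nth_le[of a i] by linarith

lemma cost_le: "\<bar>cost d b $ i $ j\<bar> \<le> (\<Sum>k\<in>UNIV. norm (d k)) * norm b"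
proof -
  have "\<bar>cost d b $ i $ j\<bar> \<le> (\<Sum>k\<in>UNIV. \<bar>b $ k * d k $ i $ j\<bar>)"
    unfolding cost_nth by (rule sum_abs)
  also have "\<dots> \<le> (\<Sum>k\<in>UNIV. norm (d k) * norm b)"
  proof (intro sum_mono)
    fix k
    have "\<bar>d k $ i $ j\<bar> \<le> norm (d k)" by (rule abs_entry_le_norm)
    then show "\<bar>b $ k * d k $ i $ j\<bar> \<le> norm (d k) * norm b"
      unfolding abs_mult using component_le_norm_cart[of b k]
      by (subst mult.commute) (intro mult_mono, auto)
  qed
  finally show ?thesis by (simp add: sum_distrib_right)
qed

text \<open>
  One coordinate of the ISTA step: \<open>(b - b') / \<rho> - g\<close> is a subgradient of
  \<open>\<gamma>|\<cdot>|\<close> at the new value \<open>b'\<close>.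
\<close>
lemma prox_subgradient:
  assumes "\<rho> > 0" "\<gamma> \<ge> 0" and b': "b' = soft_threshold (\<rho> * \<gamma>) (b - \<rho> * g)"
  shows "\<gamma> * \<bar>b'\<bar> + ((b - b') / \<rho> - g) * (w - b') \<le> \<gamma> * \<bar>w\<bar>"
proof -
  have "\<rho> * (\<gamma> * \<bar>b'\<bar> + ((b - b') / \<rho> - g) * (w - b')) = 
      \<rho> * \<gamma> * \<bar>b'\<bar> + (b - \<rho> * g - b') * (w - b')"
    using \<open>\<rho> > 0\<close> by (simp add: field_simps)
  also have "\<dots> \<le> \<rho> * (\<gamma> * \<bar>w\<bar>)"
    using soft_threshold_prox[of "\<rho> * \<gamma>" "b - \<rho> * g" w] assms by simp
  finally show ?thesis using \<open>\<rho> > 0\<close> by simp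
qed

text \<open>
  Both \<open>P\<close> and the current plan have mass 1, which bounds the gradient in \<open>\<beta>\<close>
  independently of the current point; soft thresholding adds at most \<open>\<rho>\<gamma>\<close> per coordinate.
\<close>
lemma beta_displacement:
  fixes P :: "real ^ 'n ^ 'n" and d :: "'k::finite \<Rightarrow> real ^ 'n ^ 'n"
  assumes "\<rho> > 0" "\<gamma> \<ge> 0" and P: "probability_matrix P"
    and mass: "(\<Sum>i\<in>UNIV. \<Sum>j\<in>UNIV. exp (a $ i $ j)) = 1"
    and prox: "\<And>k. \<beta>' $ k = soft_threshold (\<rho> * \<gamma>) (\<beta> $ k - \<rho> *
      (\<Sum>i\<in>UNIV. \<Sum>j\<in>UNIV. (P $ i $ j - exp (a $ i $ j)) * d k $ i $ j))"
  shows "norm (\<beta>' - \<beta>) \<le> \<rho> * (\<Sum>k\<in>UNIV. \<gamma> + 2 * norm (d k))"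
proof -
  have comp: "\<bar>\<beta>' $ k - \<beta> $ k\<bar> \<le> \<rho> * (\<gamma> + 2 * norm (d k))" for k
  proof -
    define g where "g = (\<Sum>i\<in>UNIV. \<Sum>j\<in>UNIV. (P $ i $ j - exp (a $ i $ j)) * d k $ i $ j)"
    have "\<bar>g\<bar> \<le> (\<Sum>i\<in>UNIV. \<bar>\<Sum>j\<in>UNIV. (P $ i $ j - exp (a $ i $ j)) * d k $ i $ j\<bar>)"
      unfolding g_def by (rule sum_abs)
    also have "\<dots> \<le> (\<Sum>i\<in>UNIV. \<Sum>j\<in>UNIV. \<bar>(P $ i $ j - exp (a $ i $ j)) * d k $ i $ j\<bar>)"
      by (intro sum_mono sum_abs)
    also have "\<dots> \<le> (\<Sum>i\<in>UNIV. \<Sum>j\<in>UNIV. (P $ i $ j + exp (a $ i $ j)) * norm (d k))"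
    proof (intro sum_mono)
      fix i j
      have "\<bar>d k $ i $ j\<bar> \<le> norm (d k)" by (rule abs_entry_le_norm)
      moreover have "0 \<le> P $ i $ j" using P by (simp add: probability_matrix_def)
      then have "\<bar>P $ i $ j - exp (a $ i $ j)\<bar> \<le> P $ i $ j + exp (a $ i $ j)"
        using exp_gt_zero[of "a $ i $ j"] by linarith
      ultimately show "\<bar>(P $ i $ j - exp (a $ i $ j)) * d k $ i $ j\<bar> \<le> (P $ i $ j + exp (a $ i $ j)) * norm (d k)"
        unfolding abs_mult by (intro mult_mono) auto
    qed
    also have "\<dots> = 2 * norm (d k)"
      using P mass by (simp add: sum_distrib_right[symmetric] sum.distrib probability_matrix_def)
    finally have g: "\<bar>\<rho> * g\<bar> \<le> \<rho> * (2 * norm (d k))"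
      using \<open>\<rho> > 0\<close> by (simp add: abs_mult)
    have "\<bar>\<beta>' $ k - (\<beta> $ k - \<rho> * g)\<bar> \<le> \<rho> * \<gamma>"
      unfolding g_def prox[of k] using assms(1,2) by (intro soft_threshold_dist) simp
    then show ?thesis using g by (simp add: algebra_simps)
  qed
  have "norm (\<beta>' - \<beta>) \<le> (\<Sum>k\<in>UNIV. \<bar>(\<beta>' - \<beta>) $ k\<bar>)" by (rule norm_le_l1_cart)
  also have "\<dots> \<le> (\<Sum>k\<in>UNIV. \<rho> * (\<gamma> + 2 * norm (d k)))"
    using comp by (intro sum_mono) simp
  finally show ?thesis by (simp add: sum_distrib_left)
qed

text \<open>
  The descent inequality of the proximal gradient method. A global Lipschitz constant of the gradient
  does not exist; it is replaced by the expansion of the exponential for entries moved by at most 1,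
  in which the remainder is weighted by a plan of mass 1.
\<close>
lemma ista_decrease:
  fixes P :: "real ^ 'n ^ 'n" and d :: "'k::finite \<Rightarrow> real ^ 'n ^ 'n"
  assumes "\<rho> > 0" "\<gamma> \<ge> 0"
    and mass: "(\<Sum>i\<in>UNIV. \<Sum>j\<in>UNIV. exp (log_plan d (u, v, \<beta>) $ i $ j)) = 1"
    and prox: "\<And>k. \<beta>' $ k = soft_threshold (\<rho> * \<gamma>) (\<beta> $ k - \<rho> *
      (\<Sum>i\<in>UNIV. \<Sum>j\<in>UNIV. (P $ i $ j - exp (log_plan d (u, v, \<beta>) $ i $ j)) * d k $ i $ j))"
    and D: "\<And>b i j. \<bar>cost d b $ i $ j\<bar> \<le> D * norm b"
    and small: "D * norm (\<beta>' - \<beta>) \<le> 1"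
  shows "\<Phi> P d \<gamma> (u, v, \<beta>') + (1 / \<rho> - 2 * D\<^sup>2) * (norm (\<beta>' - \<beta>))\<^sup>2 \<le> \<Phi> P d \<gamma> (u, v, \<beta>)"
proof -
  define y where "y = log_plan d (u, v, \<beta>)"
  define s where "s = log_plan d (u, v, \<beta>')"
  define g where "g k = (\<Sum>i\<in>UNIV. \<Sum>j\<in>UNIV. (P $ i $ j - exp (y $ i $ j)) * d k $ i $ j)" for k
  define e where "e = norm (\<beta>' - \<beta>)"
  have diff: "s $ i $ j - y $ i $ j = log_plan d (0, 0, \<beta>' - \<beta>) $ i $ j" for i j
    unfolding s_def y_def log_plan_diff by simp
  have bd: "\<bar>s $ i $ j - y $ i $ j\<bar> \<le> D * e" for i j
    using D[of "\<beta>' - \<beta>" i j] by (simp add: diff e_def)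
  have pt: "exp (s $ i $ j) - P $ i $ j * s $ i $ j \<le> exp (y $ i $ j) - P $ i $ j * y $ i $ j
      + (exp (y $ i $ j) - P $ i $ j) * (s $ i $ j - y $ i $ j) + exp (y $ i $ j) * (2 * (D * e)\<^sup>2)" for i j
  proof -
    let ?\<delta> = "s $ i $ j - y $ i $ j"
    have "\<bar>?\<delta>\<bar> \<le> 1" using bd[of i j] small by (simp add: e_def)
    moreover have "?\<delta>\<^sup>2 \<le> (D * e)\<^sup>2" using bd[of i j] by (rule abs_le_square_iff[THEN iffD1, OF order_trans]) simp
    ultimately have "exp ?\<delta> \<le> 1 + ?\<delta> + 2 * (D * e)\<^sup>2" using exp_le_quadratic[of ?\<delta>] by linarith
    then have "exp (y $ i $ j) * exp ?\<delta> \<le> exp (y $ i $ j) * (1 + ?\<delta> + 2 * (D * e)\<^sup>2)"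
      by (intro mult_left_mono) auto
    then show ?thesis by (simp add: exp_diff algebra_simps)
  qed
  have "energy P s \<le> energy P y
      + (\<Sum>i\<in>UNIV. \<Sum>j\<in>UNIV. (exp (y $ i $ j) - P $ i $ j) * (s $ i $ j - y $ i $ j))
      + (\<Sum>i\<in>UNIV. \<Sum>j\<in>UNIV. exp (y $ i $ j) * (2 * (D * e)\<^sup>2))"
    unfolding energy_def sum.distrib[symmetric] by (intro sum_mono pt)
  also have "(\<Sum>i\<in>UNIV. \<Sum>j\<in>UNIV. exp (y $ i $ j) * (2 * (D * e)\<^sup>2)) = 2 * (D * e)\<^sup>2"
    using mass by (simp add: y_def sum_distrib_right[symmetric] del: log_plan.simps)
  also have "(\<Sum>i\<in>UNIV. \<Sum>j\<in>UNIV. (exp (y $ i $ j) - P $ i $ j) * (s $ i $ j - y $ i $ j))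
      = (\<Sum>k\<in>UNIV. g k * (\<beta>' $ k - \<beta> $ k))"
    unfolding diff log_plan_adjoint g_def
    by (simp add: sum_negf[symmetric] sum_distrib_right left_diff_distrib sum_subtractf algebra_simps)
  finally have en: "energy P s \<le> energy P y + (\<Sum>k\<in>UNIV. g k * (\<beta>' $ k - \<beta> $ k)) + 2 * (D * e)\<^sup>2" .
  have prox': "\<beta>' $ k = soft_threshold (\<rho> * \<gamma>) (\<beta> $ k - \<rho> * g k)" for k
    unfolding g_def y_def by (rule prox)
  have "\<gamma> * \<bar>\<beta>' $ k\<bar> + g k * (\<beta>' $ k - \<beta> $ k) + (\<beta>' $ k - \<beta> $ k)\<^sup>2 / \<rho> \<le> \<gamma> * \<bar>\<beta> $ k\<bar>" for k
    using prox_subgradient[OF assms(1,2) prox', of k "\<beta> $ k"]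
    by (simp add: power2_eq_square algebra_simps diff_divide_distrib add_divide_distrib)
  then have "(\<Sum>k\<in>UNIV. \<gamma> * \<bar>\<beta>' $ k\<bar> + g k * (\<beta>' $ k - \<beta> $ k) + (\<beta>' $ k - \<beta> $ k)\<^sup>2 / \<rho>) \<le> (\<Sum>k\<in>UNIV. \<gamma> * \<bar>\<beta> $ k\<bar>)"
    by (intro sum_mono)
  moreover have "(\<Sum>k\<in>UNIV. (\<beta>' $ k - \<beta> $ k)\<^sup>2) = e\<^sup>2"
    by (simp add: e_def norm_vector_sq)
  ultimately have "\<gamma> * (\<Sum>k\<in>UNIV. \<bar>\<beta>' $ k\<bar>) + (\<Sum>k\<in>UNIV. g k * (\<beta>' $ k - \<beta> $ k)) + e\<^sup>2 / \<rho>
      \<le> \<gamma> * (\<Sum>k\<in>UNIV. \<bar>\<beta> $ k\<bar>)"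
    by (simp add: sum.distrib sum_distrib_left sum_divide_distrib[symmetric])
  then show ?thesis using en unfolding \<Phi>_eq_energy
    by (simp add: s_def y_def e_def power_mult_distrib left_diff_distrib del: log_plan.simps)
qed

section \<open>Existence, uniqueness and quadratic growth at the solution\<close>

text \<open>
  Strong convexity in midpoint form, obtained by expanding around the midpoint towards both ends: the
  first-order terms cancel.
\<close>
lemma energy_midpoint:
  assumes a: "\<And>i j. \<bar>a $ i $ j\<bar> \<le> M" and b: "\<And>i j. \<bar>b $ i $ j\<bar> \<le> M"
  shows "energy P ((1/2) *\<^sub>R (a + b)) + exp (- M) / 8 * (norm (a - b))\<^sup>2 \<le> (energy P a + energy P b) / 2"
proof -
  define c where "c = (1/2) *\<^sub>R (a + b)"
  have c: "\<bar>c $ i $ j\<bar> \<le> M" for i j using a[of i j] b[of i j] by (simp add: c_def)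
  have ac: "a - c = (1/2) *\<^sub>R (a - b)" and bc: "b - c = - ((1/2) *\<^sub>R (a - b))"
    by (simp_all add: c_def vec_eq_iff field_simps)
  have "(\<Sum>i\<in>UNIV. \<Sum>j\<in>UNIV. (exp (c $ i $ j) - P $ i $ j) * (a $ i $ j - c $ i $ j)) +
      (\<Sum>i\<in>UNIV. \<Sum>j\<in>UNIV. (exp (c $ i $ j) - P $ i $ j) * (b $ i $ j - c $ i $ j)) = 0"
    unfolding sum.distrib[symmetric] distrib_left[symmetric] by (simp add: c_def)
  moreover have "exp (- M) / 2 * (norm (a - c))\<^sup>2 = exp (- M) / 8 * (norm (a - b))\<^sup>2"
    "exp (- M) / 2 * (norm (b - c))\<^sup>2 = exp (- M) / 8 * (norm (a - b))\<^sup>2"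
    unfolding ac bc by (simp_all add: power_divide)
  ultimately show ?thesis
    using energy_strongly_convex[OF a c, of P] energy_strongly_convex[OF b c, of P]
    unfolding c_def[symmetric] by argo
qed

lemma solution_normalized: "is_solution P d \<gamma> i0 xs \<Longrightarrow> xs \<in> normalized_points i0"
  by (simp add: is_solution_def is_arg_min_def)

text \<open>
  The solution minimizes over all points, since every point has a normalized representative with the
  same value.
\<close>
lemma solution_le:
  assumes "is_solution P d \<gamma> i0 xs"
  shows "\<Phi> P d \<gamma> xs \<le> \<Phi> P d \<gamma> x"
  using assms normalize_in_normalized_points[of i0 x] \<Phi>_normalize[of P d \<gamma> i0 x]
  unfolding is_solution_def is_arg_min_def by (metis not_less)

text \<open>
  Comparing \<open>\<Phi>(x\<^sup>*)\<close> with \<open>\<Phi>\<close> at the midpoint of \<open>x\<close> and \<open>x\<^sup>*\<close> avoids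
  differentiating the nonsmooth term.
\<close>
lemma solution_quadratic_growth:
  assumes xs: "is_solution P d \<gamma> i0 xs" and "\<gamma> \<ge> 0"
    and M: "\<And>i j. \<bar>log_plan d xs $ i $ j\<bar> \<le> M" "\<And>i j. \<bar>log_plan d x $ i $ j\<bar> \<le> M"
  shows "\<Phi> P d \<gamma> xs + exp (- M) / 4 * (norm (log_plan d (x - xs)))\<^sup>2 \<le> \<Phi> P d \<gamma> x"
proof -
  obtain u v b where x: "x = (u, v, b)" by (metis prod_cases3)
  obtain us vs bs where xse: "xs = (us, vs, bs)" by (metis prod_cases3)
  define z where "z = (1/2) *\<^sub>R (x + xs)"
  have z: "z = ((1/2) *\<^sub>R (u + us), (1/2) *\<^sub>R (v + vs), (1/2) *\<^sub>R (b + bs))"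
    by (simp add: z_def x xse)
  have "log_plan d z = (1/2) *\<^sub>R (log_plan d x + log_plan d xs)"
    unfolding z_def by (simp add: linear_add[OF linear_log_plan] linear_scale[OF linear_log_plan])
  then have 1: "energy P (log_plan d z) + exp (- M) / 8 * (norm (log_plan d (x - xs)))\<^sup>2
      \<le> (energy P (log_plan d x) + energy P (log_plan d xs)) / 2"
    using energy_midpoint[OF M(2,1), of P] by (simp add: linear_diff[OF linear_log_plan])
  have "\<bar>((1/2) *\<^sub>R (b + bs)) $ k\<bar> \<le> (\<bar>b $ k\<bar> + \<bar>bs $ k\<bar>) / 2" for k by simp
  then have "(\<Sum>k\<in>UNIV. \<bar>((1/2) *\<^sub>R (b + bs)) $ k\<bar>) \<le> (\<Sum>k\<in>UNIV. (\<bar>b $ k\<bar> + \<bar>bs $ k\<bar>) / 2)"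
    by (rule sum_mono)
  also have "\<dots> = ((\<Sum>k\<in>UNIV. \<bar>b $ k\<bar>) + (\<Sum>k\<in>UNIV. \<bar>bs $ k\<bar>)) / 2"
    by (simp add: sum.distrib sum_divide_distrib[symmetric])
  finally have "\<gamma> * (\<Sum>k\<in>UNIV. \<bar>((1/2) *\<^sub>R (b + bs)) $ k\<bar>)
      \<le> \<gamma> * (((\<Sum>k\<in>UNIV. \<bar>b $ k\<bar>) + (\<Sum>k\<in>UNIV. \<bar>bs $ k\<bar>)) / 2)"
    using \<open>\<gamma> \<ge> 0\<close> by (rule mult_left_mono)
  then have 2: "\<gamma> * (\<Sum>k\<in>UNIV. \<bar>((1/2) *\<^sub>R (b + bs)) $ k\<bar>)
      \<le> (\<gamma> * (\<Sum>k\<in>UNIV. \<bar>b $ k\<bar>) + \<gamma> * (\<Sum>k\<in>UNIV. \<bar>bs $ k\<bar>)) / 2"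
    by (simp add: algebra_simps)
  have "\<Phi> P d \<gamma> z + exp (- M) / 8 * (norm (log_plan d (x - xs)))\<^sup>2 \<le> (\<Phi> P d \<gamma> x + \<Phi> P d \<gamma> xs) / 2"
    using 1 2 unfolding z x xse \<Phi>_eq_energy by argo
  then show ?thesis using solution_le[OF xs, of z] by argo
qed


lemma solution_exists:
  fixes P :: "real ^ 'n ^ 'n" and d :: "'k::finite \<Rightarrow> real ^ 'n ^ 'n"
  assumes "\<gamma> \<ge> 0" and pos: "\<forall>i j. P $ i $ j > 0"
    and C: "\<And>x. x \<in> normalized_points i0 \<Longrightarrow> norm x \<le> C * norm (log_plan d x)" "C > 0"
  shows "\<exists>xs. is_solution P d \<gamma> i0 xs"
proof -
  define S where "S = normalized_points i0 \<inter> {x. \<Phi> P d \<gamma> x \<le> \<Phi> P d \<gamma> 0}"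
  obtain M where M: "M > 0" "\<And>x i j. \<Phi> P d \<gamma> x \<le> \<Phi> P d \<gamma> 0 \<Longrightarrow> \<bar>log_plan d x $ i $ j\<bar> \<le> M"
    using log_plan_sublevel_bounded[OF pos \<open>\<gamma> \<ge> 0\<close>] by blast
  have "norm x \<le> C * sqrt (\<Sum>i::'n\<in>UNIV. \<Sum>j::'n\<in>UNIV. M\<^sup>2)" if "x \<in> S" for x
  proof -
    have "(norm (log_plan d x))\<^sup>2 \<le> (\<Sum>i::'n\<in>UNIV. \<Sum>j::'n\<in>UNIV. M\<^sup>2)"
      unfolding norm_matrix_sq using M that
      by (intro sum_mono) (auto simp: S_def abs_le_square_iff[symmetric])
    then have "norm (log_plan d x) \<le> sqrt (\<Sum>i::'n\<in>UNIV. \<Sum>j::'n\<in>UNIV. M\<^sup>2)"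
      by (rule real_le_rsqrt)
    then have "C * norm (log_plan d x) \<le> C * sqrt (\<Sum>i::'n\<in>UNIV. \<Sum>j::'n\<in>UNIV. M\<^sup>2)"
      using C(2) by (intro mult_left_mono) auto
    then show ?thesis using C(1)[of x] that by (simp add: S_def)
  qed
  then have "bounded S" unfolding bounded_iff by blast
  moreover have "closed S" unfolding S_def
    by (intro closed_Int closed_normalized closed_Collect_le continuous_\<Phi> continuous_on_const)
  ultimately have "compact S" by (simp add: compact_eq_bounded_closed)
  moreover have 0: "0 \<in> S" using subspace_normalized subspace_0 by (auto simp: S_def)
  ultimately obtain xs where xs: "xs \<in> S" "\<And>y. y \<in> S \<Longrightarrow> \<Phi> P d \<gamma> xs \<le> \<Phi> P d \<gamma> y"
    using continuous_attains_inf[of S "\<Phi> P d \<gamma>"] continuous_on_subset[OF continuous_\<Phi>] by blast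
  have "\<Phi> P d \<gamma> xs \<le> \<Phi> P d \<gamma> y" if "y \<in> normalized_points i0" for y
    using xs(2)[of y] xs(2)[OF 0] that by (cases "y \<in> S") (auto simp: S_def)
  then show ?thesis using xs(1) unfolding is_solution_def is_arg_min_def S_def
    by (intro exI[of _ xs]) (auto simp: not_less)
qed

lemma solution_unique:
  fixes P :: "real ^ 'n ^ 'n" and d :: "'k::finite \<Rightarrow> real ^ 'n ^ 'n"
  assumes "\<gamma> \<ge> 0" and pos: "\<forall>i j. P $ i $ j > 0"
    and C: "\<And>x. x \<in> normalized_points i0 \<Longrightarrow> norm x \<le> C * norm (log_plan d x)"
    and xs: "is_solution P d \<gamma> i0 xs" and ys: "is_solution P d \<gamma> i0 ys"
  shows "xs = ys"
proof -
  have eq: "\<Phi> P d \<gamma> xs = \<Phi> P d \<gamma> ys"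
    using solution_le[OF xs, of ys] solution_le[OF ys, of xs] by linarith
  obtain M where M: "M > 0" "\<And>x i j. \<Phi> P d \<gamma> x \<le> \<Phi> P d \<gamma> xs \<Longrightarrow> \<bar>log_plan d x $ i $ j\<bar> \<le> M"
    using log_plan_sublevel_bounded[OF pos \<open>\<gamma> \<ge> 0\<close>] by blast
  have "exp (- M) / 4 * (norm (log_plan d (ys - xs)))\<^sup>2 \<le> 0"
    using solution_quadratic_growth[OF xs \<open>\<gamma> \<ge> 0\<close>, of M ys] M(2) eq by fastforce
  then have "norm (log_plan d (ys - xs)) = 0"
    by (metis exp_gt_zero less_le_not_le mult_pos_pos zero_less_divide_iff zero_less_numeral
        zero_less_power2 linorder_not_less)
  moreover have "ys - xs \<in> normalized_points i0"
    by (intro subspace_diff[OF subspace_normalized] solution_normalized[OF ys] solution_normalized[OF xs])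
  ultimately show ?thesis using C[of "ys - xs"] by simp
qed

section \<open>Linear rate of the objective\<close>

text \<open>
  The step-size condition does two jobs: its first summand makes the entries of the log-plan move by
  at most 1 in the ISTA step, its second one makes the gain \<open>1/\<rho>\<close> dominate the second-order
  remainder \<open>2D\<^sup>2\<close> with \<open>1/(2\<rho>)\<close> to spare.
\<close>

lemma sista_decrease:
  fixes P :: "real ^ 'n ^ 'n" and d :: "'k::finite \<Rightarrow> real ^ 'n ^ 'n"
  assumes P: "probability_matrix P" and "\<gamma> \<ge> 0" "\<rho> > 0"
    and D: "\<And>b i j. \<bar>cost d b $ i $ j\<bar> \<le> D * norm b" "D \<ge> 0"
    and small: "\<rho> * (D * (\<Sum>k\<in>UNIV. \<gamma> + 2 * norm (d k)) + 4 * D\<^sup>2) \<le> 1"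
    and step: "sista_step P d \<gamma> \<rho> (u, v, \<beta>) (u', v', \<beta>')"
  shows "\<Phi> P d \<gamma> (u', v, \<beta>) \<le> \<Phi> P d \<gamma> (u, v, \<beta>)"
    and "\<Phi> P d \<gamma> (u', v', \<beta>) \<le> \<Phi> P d \<gamma> (u', v, \<beta>)"
    and "\<Phi> P d \<gamma> (u', v', \<beta>') + 1 / (2 * \<rho>) * (norm (\<beta>' - \<beta>))\<^sup>2 \<le> \<Phi> P d \<gamma> (u', v', \<beta>)"
proof -
  note plans = sista_step_plans[OF step]
  show "\<Phi> P d \<gamma> (u', v, \<beta>) \<le> \<Phi> P d \<gamma> (u, v, \<beta>)"
    by (rule sinkhorn_u_decrease[OF plans(1)])
  show "\<Phi> P d \<gamma> (u', v', \<beta>) \<le> \<Phi> P d \<gamma> (u', v, \<beta>)"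
    by (rule sinkhorn_v_decrease[OF plans(2)])
  let ?B = "\<Sum>k\<in>UNIV. \<gamma> + 2 * norm (d k)"
  have "(\<Sum>i\<in>UNIV. \<Sum>j\<in>UNIV. exp (log_plan d (u', v', \<beta>) $ i $ j)) = (\<Sum>j\<in>UNIV. col_margin P j)"
    unfolding plans(2)[symmetric] by (rule sum.swap)
  also have "\<dots> = (\<Sum>i\<in>UNIV. \<Sum>j\<in>UNIV. P $ i $ j)"
    unfolding col_margin_def by (rule sum.swap)
  also have "\<dots> = 1" using P by (simp add: probability_matrix_def)
  finally have mass: "(\<Sum>i\<in>UNIV. \<Sum>j\<in>UNIV. exp (log_plan d (u', v', \<beta>) $ i $ j)) = 1" .
  have "0 \<le> ?B" using \<open>\<gamma> \<ge> 0\<close> by (intro sum_nonneg) simp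
  then have nn: "0 \<le> \<rho> * (D * ?B)" "0 \<le> \<rho> * (4 * D\<^sup>2)" using \<open>\<rho> > 0\<close> \<open>D \<ge> 0\<close> by auto
  have "D * norm (\<beta>' - \<beta>) \<le> D * (\<rho> * ?B)"
    using \<open>D \<ge> 0\<close> by (intro mult_left_mono beta_displacement[OF \<open>\<rho> > 0\<close> \<open>\<gamma> \<ge> 0\<close> P mass plans(3)])
  also have "\<dots> \<le> 1" using small nn by (simp add: algebra_simps)
  finally have "D * norm (\<beta>' - \<beta>) \<le> 1" .
  from ista_decrease[OF \<open>\<rho> > 0\<close> \<open>\<gamma> \<ge> 0\<close> mass plans(3) D(1) this]
  have dec: "\<Phi> P d \<gamma> (u', v', \<beta>') + (1 / \<rho> - 2 * D\<^sup>2) * (norm (\<beta>' - \<beta>))\<^sup>2 \<le> \<Phi> P d \<gamma> (u', v', \<beta>)" .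
  have "\<rho> * (4 * D\<^sup>2) \<le> 1" using small nn by (simp add: algebra_simps)
  then have "1 / (2 * \<rho>) \<le> 1 / \<rho> - 2 * D\<^sup>2" using \<open>\<rho> > 0\<close> by (simp add: field_simps)
  then have "1 / (2 * \<rho>) * (norm (\<beta>' - \<beta>))\<^sup>2 \<le> (1 / \<rho> - 2 * D\<^sup>2) * (norm (\<beta>' - \<beta>))\<^sup>2"
    by (rule mult_right_mono) simp
  then show "\<Phi> P d \<gamma> (u', v', \<beta>') + 1 / (2 * \<rho>) * (norm (\<beta>' - \<beta>))\<^sup>2 \<le> \<Phi> P d \<gamma> (u', v', \<beta>)"
    using dec by linarith
qed

lemma abs_sum_mult_nth_le:
  fixes h :: "real ^ 'm"
  assumes "\<And>k. \<bar>A k\<bar> \<le> B k" "norm h \<le> r"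
  shows "\<bar>\<Sum>k\<in>UNIV. A k * h $ k\<bar> \<le> (\<Sum>k\<in>UNIV. B k) * r"
proof -
  have "\<bar>\<Sum>k\<in>UNIV. A k * h $ k\<bar> \<le> (\<Sum>k\<in>UNIV. \<bar>A k * h $ k\<bar>)" by (rule sum_abs)
  also have "\<dots> \<le> (\<Sum>k\<in>UNIV. B k * r)"
  proof (intro sum_mono)
    fix k
    have "\<bar>h $ k\<bar> \<le> r" using component_le_norm_cart[of h k] assms(2) by linarith
    moreover have "0 \<le> B k" using assms(1)[of k] by linarith
    ultimately show "\<bar>A k * h $ k\<bar> \<le> B k * r"
      unfolding abs_mult using assms(1)[of k] by (intro mult_mono) auto
  qed
  finally show ?thesis by (simp add: sum_distrib_right)
qed

text \<open>
  Strong convexity at the new point, with a subgradient built from differences of plans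
  within the step (and \<open>(\<beta> - \<beta>') / \<rho>\<close>). In \<open>u\<close> the reference is the plan after the
  first substep, which has the right row sums; in \<open>v\<close> and \<open>\<beta>\<close> it is the plan after the
  second one, which has the right column sums and supplies the gradient of the ISTA step. The point
  \<open>h\<close> stands for \<open>z\<close> minus the new iterate, up to the invariant direction: only its
  log-plan and its last component are prescribed, so that it can be chosen normalized later.
\<close>
lemma sista_subgradient_bound:
  fixes P :: "real ^ 'n ^ 'n" and d :: "'k::finite \<Rightarrow> real ^ 'n ^ 'n"
  assumes "\<gamma> \<ge> 0" "\<rho> > 0"
    and D: "\<And>b i j. \<bar>cost d b $ i $ j\<bar> \<le> D * norm b" "D \<ge> 0"
    and step: "sista_step P d \<gamma> \<rho> (u, v, \<beta>) (u', v', \<beta>')"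
    and Mw: "\<And>i j. \<bar>log_plan d (u', v, \<beta>) $ i $ j\<bar> \<le> M"
    and My: "\<And>i j. \<bar>log_plan d (u', v', \<beta>) $ i $ j\<bar> \<le> M"
    and Mx: "\<And>i j. \<bar>log_plan d (u', v', \<beta>') $ i $ j\<bar> \<le> M"
    and Mz: "\<And>i j. \<bar>log_plan d z $ i $ j\<bar> \<le> M"
    and h: "log_plan d h = log_plan d z - log_plan d (u', v', \<beta>')" "snd (snd h) = snd (snd z) - \<beta>'"
    and e: "e = norm (v' - v) + norm (\<beta>' - \<beta>)"
    and L: "L = exp M * (1 + D)"
    and T: "T = 2 * (real CARD('n))\<^sup>2 * L + (\<Sum>k\<in>UNIV. 1 / \<rho> + (\<Sum>i\<in>UNIV. \<Sum>j\<in>UNIV. L * \<bar>d k $ i $ j\<bar>))"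
  shows "\<Phi> P d \<gamma> (u', v', \<beta>') + exp (- M) / 2 * (norm (log_plan d h))\<^sup>2 - T * e * norm h \<le> \<Phi> P d \<gamma> z"
proof -
  note plans = sista_step_plans[OF step]
  obtain hu hv hb where he: "h = (hu, hv, hb)" by (metis prod_cases3)
  obtain zu zv zb where ze: "z = (zu, zv, zb)" by (metis prod_cases3)
  have hbe: "hb = zb - \<beta>'" using h(2) by (simp add: he ze)
  define w where "w = log_plan d (u', v, \<beta>)"
  define y where "y = log_plan d (u', v', \<beta>)"
  define x where "x = log_plan d (u', v', \<beta>')"
  define g where "g k = (\<Sum>i\<in>UNIV. \<Sum>j\<in>UNIV. (P $ i $ j - exp (y $ i $ j)) * d k $ i $ j)" for k
  define Au where "Au i = (\<Sum>j\<in>UNIV. exp (x $ i $ j) - P $ i $ j)" for i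
  define Av where "Av j = (\<Sum>i\<in>UNIV. exp (x $ i $ j) - P $ i $ j)" for j
  define G where "G k = (\<Sum>i\<in>UNIV. \<Sum>j\<in>UNIV. (exp (x $ i $ j) - P $ i $ j) * d k $ i $ j)" for k
  (* Au, Av and Ab form a subgradient at the new point: g is the gradient used by the
     algorithm, so the prox contributes (\<beta> - \<beta>') / \<rho> - g, and -G is the smooth part. *)
  define Ab where "Ab k = (\<beta> $ k - \<beta>' $ k) / \<rho> - g k - G k" for k
  have e0: "0 \<le> e" by (simp add: e)
  have Db: "D * norm (\<beta>' - \<beta>) \<le> D * e" using D(2) by (intro mult_left_mono) (simp_all add: e)
  have xy: "\<bar>exp (x $ i $ j) - exp (y $ i $ j)\<bar> \<le> L * e" for i j
  proof -
    have "\<bar>x $ i $ j - y $ i $ j\<bar> = \<bar>cost d (\<beta>' - \<beta>) $ i $ j\<bar>"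
      by (simp add: x_def y_def linear_diff[OF linear_cost])
    also have "\<dots> \<le> (1 + D) * e" using D(1)[of "\<beta>' - \<beta>" i j] Db e0 by (simp add: algebra_simps)
    finally have "exp M * \<bar>x $ i $ j - y $ i $ j\<bar> \<le> L * e" by (simp add: L)
    then show ?thesis
      using exp_lipschitz[of "y $ i $ j" M "x $ i $ j"] My[of i j] Mx[of i j] by (simp add: x_def y_def abs_le_iff)
  qed
  have xw: "\<bar>exp (x $ i $ j) - exp (w $ i $ j)\<bar> \<le> L * e" for i j
  proof -
    have "\<bar>x $ i $ j - w $ i $ j\<bar> = \<bar>(v' - v) $ j - cost d (\<beta>' - \<beta>) $ i $ j\<bar>"
      by (simp add: x_def w_def linear_diff[OF linear_cost])
    also have "\<dots> \<le> \<bar>(v' - v) $ j\<bar> + \<bar>cost d (\<beta>' - \<beta>) $ i $ j\<bar>" by (rule abs_triangle_ineq4)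
    also have "\<dots> \<le> norm (v' - v) + D * e"
      using D(1)[of "\<beta>' - \<beta>" i j] Db component_le_norm_cart[of "v' - v" j] by linarith
    also have "\<dots> \<le> (1 + D) * e" by (simp add: e algebra_simps)
    finally have "exp M * \<bar>x $ i $ j - w $ i $ j\<bar> \<le> L * e" by (simp add: L)
    then show ?thesis
      using exp_lipschitz[of "w $ i $ j" M "x $ i $ j"] Mw[of i j] Mx[of i j] by (simp add: x_def w_def abs_le_iff)
  qed
  have Au: "\<bar>Au i\<bar> \<le> real CARD('n) * (L * e)" for i
  proof -
    have "Au i = (\<Sum>j\<in>UNIV. exp (x $ i $ j) - exp (w $ i $ j))"
      using plans(1)[of i] by (simp add: Au_def w_def sum_subtractf row_margin_def del: log_plan.simps)
    also have "\<bar>\<dots>\<bar> \<le> (\<Sum>j::'n\<in>UNIV. L * e)" by (rule order_trans[OF sum_abs]) (intro sum_mono xw)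
    finally show ?thesis by simp
  qed
  have Av: "\<bar>Av j\<bar> \<le> real CARD('n) * (L * e)" for j
  proof -
    have "Av j = (\<Sum>i\<in>UNIV. exp (x $ i $ j) - exp (y $ i $ j))"
      using plans(2)[of j] by (simp add: Av_def y_def sum_subtractf col_margin_def del: log_plan.simps)
    also have "\<bar>\<dots>\<bar> \<le> (\<Sum>i::'n\<in>UNIV. L * e)" by (rule order_trans[OF sum_abs]) (intro sum_mono xy)
    finally show ?thesis by simp
  qed
  have Ab: "\<bar>Ab k\<bar> \<le> e / \<rho> + (\<Sum>i\<in>UNIV. \<Sum>j\<in>UNIV. (L * e) * \<bar>d k $ i $ j\<bar>)" for k
  proof -
    have "- g k - G k = (\<Sum>i\<in>UNIV. \<Sum>j\<in>UNIV. (exp (y $ i $ j) - exp (x $ i $ j)) * d k $ i $ j)"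
      unfolding g_def G_def sum_negf[symmetric] sum_subtractf[symmetric] by (simp add: algebra_simps)
    also have "\<bar>\<dots>\<bar> \<le> (\<Sum>i\<in>UNIV. \<Sum>j\<in>UNIV. \<bar>(exp (y $ i $ j) - exp (x $ i $ j)) * d k $ i $ j\<bar>)"
      by (rule order_trans[OF sum_abs]) (intro sum_mono sum_abs)
    also have "\<dots> \<le> (\<Sum>i\<in>UNIV. \<Sum>j\<in>UNIV. (L * e) * \<bar>d k $ i $ j\<bar>)"
      unfolding abs_mult using xy by (intro sum_mono mult_right_mono) (simp_all add: abs_minus_commute)
    finally have 1: "\<bar>- g k - G k\<bar> \<le> (\<Sum>i\<in>UNIV. \<Sum>j\<in>UNIV. (L * e) * \<bar>d k $ i $ j\<bar>)" .
    have "\<bar>\<beta> $ k - \<beta>' $ k\<bar> \<le> e"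
      using component_le_norm_cart[of "\<beta>' - \<beta>" k] by (simp add: e abs_minus_commute add_increasing)
    then have 2: "\<bar>(\<beta> $ k - \<beta>' $ k) / \<rho>\<bar> \<le> e / \<rho>"
      using \<open>\<rho> > 0\<close> by (simp add: divide_right_mono)
    show ?thesis using 1 2 unfolding Ab_def by linarith
  qed
  have "norm hu \<le> norm h" "norm hv \<le> norm h" "norm hb \<le> norm h"
    using norm_fst_le[of hu "(hv, hb)"] norm_snd_le[of "(hv, hb)" hu] norm_fst_le[of hv hb] norm_snd_le[of hb hv]
    unfolding he by linarith+
  from abs_sum_mult_nth_le[of Au, OF Au this(1)] abs_sum_mult_nth_le[of Av, OF Av this(2)]
    abs_sum_mult_nth_le[of Ab, OF Ab this(3)]
  have "\<bar>(\<Sum>i\<in>UNIV. Au i * hu $ i) + (\<Sum>j\<in>UNIV. Av j * hv $ j) + (\<Sum>k\<in>UNIV. Ab k * hb $ k)\<bar>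
     \<le> (\<Sum>i::'n\<in>UNIV. real CARD('n) * (L * e)) * norm h + (\<Sum>i::'n\<in>UNIV. real CARD('n) * (L * e)) * norm h
       + (\<Sum>k\<in>UNIV. e / \<rho> + (\<Sum>i\<in>UNIV. \<Sum>j\<in>UNIV. (L * e) * \<bar>d k $ i $ j\<bar>)) * norm h"
    by linarith
  also have "(\<Sum>k\<in>UNIV. e / \<rho> + (\<Sum>i\<in>UNIV. \<Sum>j\<in>UNIV. (L * e) * \<bar>d k $ i $ j\<bar>))
      = (\<Sum>k\<in>UNIV. 1 / \<rho> + (\<Sum>i\<in>UNIV. \<Sum>j\<in>UNIV. L * \<bar>d k $ i $ j\<bar>)) * e"
    unfolding sum_distrib_right distrib_right by (simp add: mult_ac)
  finally have lin: "- (T * e * norm h) \<le>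
      (\<Sum>i\<in>UNIV. Au i * hu $ i) + (\<Sum>j\<in>UNIV. Av j * hv $ j) + (\<Sum>k\<in>UNIV. Ab k * hb $ k)"
    unfolding T by (simp add: algebra_simps power2_eq_square abs_le_iff)
  have xh: "log_plan d z $ i $ j - x $ i $ j = log_plan d (hu, hv, hb) $ i $ j" for i j
    using h(1) by (simp add: he x_def del: log_plan.simps)
  have "energy P x + ((\<Sum>i\<in>UNIV. Au i * hu $ i) + (\<Sum>j\<in>UNIV. Av j * hv $ j) - (\<Sum>k\<in>UNIV. G k * hb $ k))
      + exp (- M) / 2 * (norm (log_plan d h))\<^sup>2 \<le> energy P (log_plan d z)"
    using energy_strongly_convex[OF Mz Mx, of P]
    unfolding Au_def Av_def G_def log_plan_adjoint[symmetric] xh[symmetric] h(1) x_def .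
  moreover have "\<gamma> * \<bar>\<beta>' $ k\<bar> + (Ab k + G k) * hb $ k \<le> \<gamma> * \<bar>zb $ k\<bar>" for k
    using prox_subgradient[OF assms(2,1) plans(3), of k "zb $ k"]
    by (simp add: Ab_def hbe g_def y_def del: log_plan.simps)
  then have "(\<Sum>k\<in>UNIV. \<gamma> * \<bar>\<beta>' $ k\<bar> + (Ab k + G k) * hb $ k) \<le> (\<Sum>k\<in>UNIV. \<gamma> * \<bar>zb $ k\<bar>)"
    by (rule sum_mono)
  ultimately show ?thesis
    using lin unfolding ze \<Phi>_eq_energy x_def
    by (simp add: sum.distrib sum_distrib_left distrib_right del: log_plan.simps)
qed


text \<open>
  The error after a step is at most \<open>T C e r - m r\<^sup>2 / 2\<close>, where \<open>e\<close> is the length of the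
  step in \<open>(v, \<beta>)\<close> and \<open>r\<close> the distance to the solution in log-plan norm. Maximizing over
  \<open>r\<close> leaves a multiple of \<open>e\<^sup>2\<close>, which the decrease of the objective dominates. Because
  \<open>\<Phi>\<close> decreases in every substep, one bound \<open>M\<close> serves all the log-plans involved.
\<close>
lemma sista_error_bound:
  fixes P :: "real ^ 'n ^ 'n" and d :: "'k::finite \<Rightarrow> real ^ 'n ^ 'n"
  assumes P: "probability_matrix P" and pos: "\<forall>i j. P $ i $ j > 0" and "\<gamma> \<ge> 0" "\<rho> > 0"
    and D: "\<And>b i j. \<bar>cost d b $ i $ j\<bar> \<le> D * norm b" "D \<ge> 0"
    and small: "\<rho> * (D * (\<Sum>k\<in>UNIV. \<gamma> + 2 * norm (d k)) + 4 * D\<^sup>2) \<le> 1"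
    and C: "\<And>x. x \<in> normalized_points i0 \<Longrightarrow> norm x \<le> C * norm (log_plan d x)" "C > 0"
    and xs: "is_solution P d \<gamma> i0 xs"
  obtains \<kappa> where "\<kappa> > 0"
    "\<And>x x'. sista_step P d \<gamma> \<rho> x x' \<Longrightarrow> \<Phi> P d \<gamma> x \<le> c \<Longrightarrow>
      \<Phi> P d \<gamma> x' - \<Phi> P d \<gamma> xs \<le> \<kappa> * (\<Phi> P d \<gamma> x - \<Phi> P d \<gamma> x')"
proof -
  obtain M where M: "M > 0" "\<And>x i j. \<Phi> P d \<gamma> x \<le> c \<Longrightarrow> \<bar>log_plan d x $ i $ j\<bar> \<le> M"
    using log_plan_sublevel_bounded[OF pos \<open>\<gamma> \<ge> 0\<close>] by blast
  define m where "m = exp (- M)"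
  define L where "L = exp M * (1 + D)"
  define T where "T = 2 * (real CARD('n))\<^sup>2 * L
    + (\<Sum>k\<in>UNIV. 1 / \<rho> + (\<Sum>i\<in>UNIV. \<Sum>j\<in>UNIV. L * \<bar>d k $ i $ j\<bar>))"
  define q where "q = min (m / 2) (1 / (2 * \<rho>))"
  define \<kappa> where "\<kappa> = (T * C)\<^sup>2 / (m * q)"
  have m0: "m > 0" by (simp add: m_def)
  have q0: "q > 0" using m0 \<open>\<rho> > 0\<close> by (simp add: q_def)
  have L0: "L > 0" using D(2) by (simp add: L_def)
  have T0: "T > 0" unfolding T_def using L0 \<open>\<rho> > 0\<close>
    by (intro add_pos_nonneg) (auto intro!: sum_nonneg add_nonneg_nonneg)
  have \<kappa>0: "\<kappa> > 0" using m0 q0 T0 C(2) by (simp add: \<kappa>_def)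
  have "\<Phi> P d \<gamma> x' - \<Phi> P d \<gamma> xs \<le> \<kappa> * (\<Phi> P d \<gamma> x - \<Phi> P d \<gamma> x')"
    if step: "sista_step P d \<gamma> \<rho> x x'" and c: "\<Phi> P d \<gamma> x \<le> c" for x x'
  proof -
    obtain u v \<beta> where x: "x = (u, v, \<beta>)" by (metis prod_cases3)
    obtain u' v' \<beta>' where x': "x' = (u', v', \<beta>')" by (metis prod_cases3)
    note step = step[unfolded x x']
    note dec = sista_decrease[OF P \<open>\<gamma> \<ge> 0\<close> \<open>\<rho> > 0\<close> D small step]
    define e1 where "e1 = norm (v' - v)"
    define e2 where "e2 = norm (\<beta>' - \<beta>)"
    define e where "e = e1 + e2"
    define E where "E = \<Phi> P d \<gamma> x - \<Phi> P d \<gamma> x'"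
    have "0 \<le> 1 / (2 * \<rho>) * e2\<^sup>2" using \<open>\<rho> > 0\<close> by simp
    then have cw: "\<Phi> P d \<gamma> (u', v, \<beta>) \<le> c" and cy: "\<Phi> P d \<gamma> (u', v', \<beta>) \<le> c"
      and cx: "\<Phi> P d \<gamma> (u', v', \<beta>') \<le> c"
      using dec c unfolding x e2_def by linarith+
    have cs: "\<Phi> P d \<gamma> xs \<le> c" using solution_le[OF xs, of x] c by linarith
    have "\<Phi> P d \<gamma> (u', v', \<beta>) + m / 2 * e1\<^sup>2 \<le> \<Phi> P d \<gamma> (u', v, \<beta>)"
      unfolding m_def e1_def
      by (rule sinkhorn_v_strong_decrease[OF sista_step_plans(2)[OF step] M(2)[OF cw] M(2)[OF cy]])
    then have "m / 2 * e1\<^sup>2 + 1 / (2 * \<rho>) * e2\<^sup>2 \<le> E"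
      using dec unfolding E_def x x' e2_def by linarith
    moreover have "q * e1\<^sup>2 \<le> m / 2 * e1\<^sup>2" "q * e2\<^sup>2 \<le> 1 / (2 * \<rho>) * e2\<^sup>2"
      unfolding q_def by (rule mult_right_mono; simp)+
    moreover have "q * e\<^sup>2 \<le> q * (2 * (e1\<^sup>2 + e2\<^sup>2))"
      using q0 sum_squares_bound[of e1 e2] by (intro mult_left_mono) (auto simp: e_def power2_sum)
    ultimately have qe: "q * e\<^sup>2 \<le> 2 * E" by (simp add: algebra_simps)
    (* Without normalizing x' the norm of h would not be controlled by its log-plan. *)
    define h where "h = xs - normalize_point i0 x'"
    have hn: "h \<in> normalized_points i0" unfolding h_def
      by (intro subspace_diff[OF subspace_normalized] solution_normalized[OF xs] normalize_in_normalized_points)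
    have hl: "log_plan d h = log_plan d xs - log_plan d (u', v', \<beta>')"
      unfolding h_def x' linear_diff[OF linear_log_plan] log_plan_normalize ..
    have hb: "snd (snd h) = snd (snd xs) - \<beta>'" by (simp add: h_def x')
    define r where "r = norm (log_plan d h)"
    have "\<Phi> P d \<gamma> x' + m / 2 * r\<^sup>2 - T * e * norm h \<le> \<Phi> P d \<gamma> xs"
      unfolding m_def r_def x'
      by (rule sista_subgradient_bound[OF \<open>\<gamma> \<ge> 0\<close> \<open>\<rho> > 0\<close> D step M(2)[OF cw] M(2)[OF cy] M(2)[OF cx]
            M(2)[OF cs] hl hb e_def[unfolded e1_def e2_def] L_def T_def])
    moreover have "T * e * norm h \<le> T * e * (C * r)"
      using C(1)[OF hn] T0 by (intro mult_left_mono) (auto simp: r_def e_def e1_def e2_def)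
    moreover have "T * C * e * r \<le> m / 2 * r\<^sup>2 + (T * C * e)\<^sup>2 / (2 * m)"
    proof -
      have "0 \<le> (m * r - T * C * e)\<^sup>2 / (2 * m)" using m0 by simp
      also have "\<dots> = m / 2 * r\<^sup>2 + (T * C * e)\<^sup>2 / (2 * m) - T * C * e * r"
        using m0 by (simp add: power2_eq_square field_simps)
      finally show ?thesis by simp
    qed
    moreover have "(T * C * e)\<^sup>2 / (2 * m) \<le> \<kappa> * E"
    proof -
      have "(T * C * e)\<^sup>2 / (2 * m) = (T * C)\<^sup>2 / (2 * m * q) * (q * e\<^sup>2)"
        using q0 by (simp add: power_mult_distrib)
      also have "\<dots> \<le> (T * C)\<^sup>2 / (2 * m * q) * (2 * E)"
        using qe m0 q0 by (intro mult_left_mono) auto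
      also have "\<dots> = \<kappa> * E" by (simp add: \<kappa>_def)
      finally show ?thesis .
    qed
    ultimately show ?thesis unfolding E_def by (simp add: mult_ac)
  qed
  then show thesis using that \<kappa>0 by blast
qed

section \<open>Convergence of SISTA\<close>

theorem theorem3p1:
  fixes P :: "real ^ 'n ^ 'n" and d :: "'k::finite \<Rightarrow> real ^ 'n ^ 'n"
    and \<gamma> :: real and i0 :: 'n
  assumes prob: "probability_matrix P"
    and gamma: "\<gamma> > 0"
    and margins: "\<forall>k. (\<forall>j. (\<Sum>i\<in>UNIV. d k $ i $ j) = 0) \<and> (\<forall>i. (\<Sum>j\<in>UNIV. d k $ i $ j) = 0)"
    and indep: "inj d" "independent (range d)"
    and pos: "\<forall>i j. P $ i $ j > 0"
  shows "(\<exists>!xs. is_solution P d \<gamma> i0 xs) \<and>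
    (\<forall>xs. is_solution P d \<gamma> i0 xs \<longrightarrow>
      (\<exists>\<rho>0>0. \<forall>\<rho>. 0 < \<rho> \<and> \<rho> < \<rho>0 \<longrightarrow>
        (\<forall>x. sista_sequence P d \<gamma> \<rho> x \<longrightarrow>
          (\<lambda>t. normalize_point i0 (x t)) \<longlonglongrightarrow> xs \<and>
          (\<exists>\<delta>>0. \<forall>t. \<Phi> P d \<gamma> (x t) - \<Phi> P d \<gamma> xs
                     \<le> (\<Phi> P d \<gamma> (x 0) - \<Phi> P d \<gamma> xs) / (1 + \<delta>) ^ t))))"
proof -
  have g0: "\<gamma> \<ge> 0" using gamma by simp
  obtain C where C: "C > 0" "\<And>x. x \<in> normalized_points i0 \<Longrightarrow> norm x \<le> C * norm (log_plan d x)"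
    using log_plan_bounded_below[OF margins indep] by blast
  define D where "D = (\<Sum>k\<in>UNIV. norm (d k))"
  have D: "\<And>b i j. \<bar>cost d b $ i $ j\<bar> \<le> D * norm b" "D \<ge> 0"
    using cost_le[of d] by (auto simp: D_def sum_nonneg)
  (* The threshold 1 / (S + 1) is chosen before the sequence; the added 1 covers S = 0. *)
  define S where "S = D * (\<Sum>k\<in>UNIV. \<gamma> + 2 * norm (d k)) + 4 * D\<^sup>2"
  have S0: "S \<ge> 0" unfolding S_def using D(2) g0
    by (intro add_nonneg_nonneg mult_nonneg_nonneg sum_nonneg) auto
  have unique: "\<exists>!xs. is_solution P d \<gamma> i0 xs"
    using solution_exists[OF g0 pos C(2,1)] solution_unique[OF g0 pos C(2)] by blast
  have conv: "(\<lambda>t. normalize_point i0 (x t)) \<longlonglongrightarrow> xs \<and>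
          (\<exists>\<delta>>0. \<forall>t. \<Phi> P d \<gamma> (x t) - \<Phi> P d \<gamma> xs
                     \<le> (\<Phi> P d \<gamma> (x 0) - \<Phi> P d \<gamma> xs) / (1 + \<delta>) ^ t)"
    if xs: "is_solution P d \<gamma> i0 xs" and \<rho>: "0 < \<rho>" "\<rho> < 1 / (S + 1)"
      and seq: "sista_sequence P d \<gamma> \<rho> x" for xs \<rho> x
  proof -
    have "\<rho> * (S + 1) < 1" using \<rho>(2) S0 by (simp add: field_simps)
    then have small: "\<rho> * S \<le> 1" using \<rho>(1) by (simp add: algebra_simps)
    have step: "sista_step P d \<gamma> \<rho> (x t) (x (Suc t))" for t
      using seq by (simp add: sista_sequence_def)
    have mono: "\<Phi> P d \<gamma> (x (Suc t)) \<le> \<Phi> P d \<gamma> (x t)" for t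
    proof -
      obtain u v \<beta> where xt: "x t = (u, v, \<beta>)" by (metis prod_cases3)
      obtain u' v' \<beta>' where xt': "x (Suc t) = (u', v', \<beta>')" by (metis prod_cases3)
      have "0 \<le> 1 / (2 * \<rho>) * (norm (\<beta>' - \<beta>))\<^sup>2" using \<rho>(1) by simp
      then show ?thesis
        using sista_decrease[OF prob g0 \<rho>(1) D small[unfolded S_def] step[of t, unfolded xt xt']]
        unfolding xt xt' by linarith
    qed
    have le0: "\<Phi> P d \<gamma> (x t) \<le> \<Phi> P d \<gamma> (x 0)" for t
      by (induction t) (auto intro: order_trans[OF mono])
    obtain \<kappa> where \<kappa>: "\<kappa> > 0"
      "\<And>y y'. sista_step P d \<gamma> \<rho> y y' \<Longrightarrow> \<Phi> P d \<gamma> y \<le> \<Phi> P d \<gamma> (x 0) \<Longrightarrow>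
        \<Phi> P d \<gamma> y' - \<Phi> P d \<gamma> xs \<le> \<kappa> * (\<Phi> P d \<gamma> y - \<Phi> P d \<gamma> y')"
      using sista_error_bound[OF prob pos g0 \<rho>(1) D small[unfolded S_def] C(2,1) xs] by blast
    define \<delta> where "\<delta> = 1 / \<kappa>"
    have \<delta>: "\<delta> > 0" using \<kappa>(1) by (simp add: \<delta>_def)
    define gap where "gap t = \<Phi> P d \<gamma> (x t) - \<Phi> P d \<gamma> xs" for t
    have gap_step: "gap (Suc t) * (1 + \<delta>) \<le> gap t" for t
      using \<kappa>(2)[OF step le0, of t] \<kappa>(1) by (simp add: gap_def \<delta>_def field_simps)
    have rate: "gap t \<le> gap 0 / (1 + \<delta>) ^ t" for t
    proof (induction t)
      case (Suc t)
      have "gap (Suc t) \<le> gap t / (1 + \<delta>)" using gap_step[of t] \<delta> by (simp add: field_simps)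
      also have "\<dots> \<le> gap 0 / (1 + \<delta>) ^ t / (1 + \<delta>)" using Suc \<delta> by (intro divide_right_mono) auto
      finally show ?case by (simp add: mult.commute)
    qed simp
    obtain M where M: "M > 0" "\<And>y i j. \<Phi> P d \<gamma> y \<le> \<Phi> P d \<gamma> (x 0) \<Longrightarrow> \<bar>log_plan d y $ i $ j\<bar> \<le> M"
      using log_plan_sublevel_bounded[OF pos g0] by blast
    define A where "A = C * sqrt (4 / exp (- M))"
    have dist: "norm (normalize_point i0 (x t) - xs) \<le> A * sqrt (gap t)" for t
    proof -
      let ?z = "normalize_point i0 (x t)"
      have "exp (- M) / 4 * (norm (log_plan d (?z - xs)))\<^sup>2 \<le> gap t"
        using solution_quadratic_growth[OF xs g0, of M ?z] M(2)[OF solution_le[OF xs]] M(2)[OF le0[of t]]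
        by (simp add: gap_def \<Phi>_normalize log_plan_normalize)
      then have "norm (log_plan d (?z - xs)) \<le> sqrt (4 / exp (- M)) * sqrt (gap t)"
        unfolding real_sqrt_mult[symmetric] by (intro real_le_rsqrt) (simp add: field_simps)
      then have "C * norm (log_plan d (?z - xs)) \<le> A * sqrt (gap t)"
        using mult_left_mono[of _ _ C] C(1) unfolding A_def mult.assoc by auto
      moreover have "?z - xs \<in> normalized_points i0"
        by (intro subspace_diff[OF subspace_normalized] solution_normalized[OF xs] normalize_in_normalized_points)
      ultimately show ?thesis using C(2)[of "?z - xs"] by linarith
    qed
    have "(\<lambda>t. (1 / (1 + \<delta>)) ^ t) \<longlonglongrightarrow> 0" using \<delta> by (intro LIMSEQ_realpow_zero) auto
    then have "(\<lambda>t. gap 0 * (1 / (1 + \<delta>)) ^ t) \<longlonglongrightarrow> 0" by (rule tendsto_mult_right_zero)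
    then have lim0: "(\<lambda>t. gap 0 / (1 + \<delta>) ^ t) \<longlonglongrightarrow> 0" by (simp add: power_divide)
    have "gap \<longlonglongrightarrow> 0"
      by (rule tendsto_sandwich[OF _ _ tendsto_const lim0])
        (use rate solution_le[OF xs] in \<open>auto simp: gap_def intro!: always_eventually\<close>)
    then have "(\<lambda>t. sqrt (gap t)) \<longlonglongrightarrow> 0"
      using tendsto_real_sqrt[of gap 0] by simp
    then have "(\<lambda>t. A * sqrt (gap t)) \<longlonglongrightarrow> 0" by (rule tendsto_mult_right_zero)
    then have "(\<lambda>t. normalize_point i0 (x t) - xs) \<longlonglongrightarrow> 0"
      by (rule Lim_null_comparison[rotated]) (use dist in \<open>auto intro!: always_eventually\<close>)
    then have "(\<lambda>t. normalize_point i0 (x t)) \<longlonglongrightarrow> xs" by (simp add: LIM_zero_iff)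
    then show ?thesis using rate \<delta> unfolding gap_def by blast
  qed
  have "1 / (S + 1) > 0" using S0 by simp
  then show ?thesis using unique conv by blast
qed

end
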